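(* Let $\ell\ge 3$ and let $I$ be an ideal of $\Phi^+(D_\ell)$ such that $\epsilon_1+\epsilon_\ell\in I$ and $\epsilon_1-\epsilon_\ell\in I$. Let $\mathcal{SG}(I)=(p_1,\dots,p_\ell)$, and let $K\subseteq\Phi^+(B_\ell)$ and $U_1,\dots,U_\ell\subseteq\Phi^+(B_{\ell-1})$ be the ideals associated with $I$ as defined in the context. Then for every even positive integer $q$, $$\chi^{\mathrm{quasi}}_{S_I}(D_\ell,q)=\frac12\left(\sum_{k=1}^{\ell}\chi^{\mathrm{quasi}}_{T_{U_k}}(B_{\ell-1},q)+\chi^{\mathrm{quasi}}_{T_K}(B_\ell,q)+\prod_{i=1}^{\ell}(q-p_i)\right).$$
   Context: Let $\epsilon_1,\epsilon_2,\dots$ be orthonormal vectors in a Euclidean space. Type $B_n$ ($n\ge2$): positive roots $\Phi^+(B_n)=\{\epsilon_i\ (1\le i\le n),\ \epsilon_i\pm\epsilon_j\ (1\le i<j\le n)\}$, simple roots $\alpha_i=\epsilon_i-\epsilon_{i+1}$ ($1\le i\le n-1$), $\alpha_n=\epsilon_n$. Type $D_\ell$ ($\ell\ge 3$): positive roots $\Phi^+(D_\ell)=\{\epsilon_i\pm\epsilon_j\ (1\le i<j\le\ell)\}$, simple roots $\alpha_i=\epsilon_i-\epsilon_{i+1}$ ($1\le i\le\ell-1$), $\alpha_\ell=\epsilon_{\ell-1}+\epsilon_\ell$. On positive roots, $\beta_1\succeq\beta_2$ means that $\beta_1-\beta_2$ is a linear combination of simple roots with nonnegative integer coefficients. A subset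 $I\subseteq\Phi^+$ is an ideal if $\beta_1\in I$, $\beta_2\in\Phi^+$ and $\beta_1\succeq\beta_2$ imply $\beta_2\in I$. For a set $\Psi$ of positive roots in a root system $\Phi$ of rank $n$, $T_\Psi$ (resp. $S_\Psi$) is the $n\times\#\Psi$ integer matrix whose columns are the coordinate vectors of the elements of $\Psi$ with respect to $\epsilon_1,\dots,\epsilon_n$ (resp. with respect to the simple roots $\alpha_1,\dots,\alpha_n$ of $\Phi$). For $M=T_\Psi$ or $M=S_\Psi$ and a positive integer $q$, $$\chi^{\mathrm{quasi}}_{M}(\Phi,q):=\#\{\mathbf z\in(\mathbb Z/q\mathbb Z)^n\mid\text{every entry of }\mathbf z\cdot M\text{ is nonzero in }\mathbb Z/q\mathbb Z\}.$$ For a subset $\Psi$ of $\Phi^+(B_n)$ or $\Phi^+(D_n)$, $\mathcal{SG}(\Psi)=(p_1,\dots,p_n)$ where $p_i:=\#\{j>i\mid\epsilon_i+\epsilon_j\in\Psi\}+\#\{j>i\mid\epsilon_i-\epsilon_j\in\Psi\}+\#(\{\epsilon_i\}\cap\Psi)$. An ideal of $\Phi^+(B_n)$ is uniquely determined by this sequence, because for fixed $i$ the roots $\epsilon_i-\epsilon_{i+1}\prec\dots\prec\epsilon_i-\epsilon_n\prec\epsilon_i\prec\epsilon_i+\epsilon_n\prec\dots\prec\epsilon_i+\epsilon_{i+1}$ form a chain. Given an ideal $I$ of $\Phi^+(D_\ell)$ with $\epsilon_1\pm\epsilon_\ell\in I$ and $\mathcal{SG}(I)=(p_1,\dots,p_\ell)$,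 let $s:=\min\{2\le k\le\ell\mid\epsilon_{k-1}+\epsilon_k\in I\}$, and for $1\le n\le s-2$, $s-1\le k\le\ell$ let $\tau_{n,k}:=1$ if $\epsilon_n+\epsilon_k\in I$ and $\tau_{n,k}:=0$ otherwise. For $1\le k\le\ell$, $U_k$ is the ideal of $\Phi^+(B_{\ell-1})$ with: - for $1\le k\le s-2$: $\mathcal{SG}(U_k)=(p_1,\dots,p_{k-1},p_{k+1}+1,\dots,p_\ell+1)$; - for $s-1\le k\le\ell$: $\mathcal{SG}(U_k)=(p_1-\tau_{1,k},\dots,p_{s-2}-\tau_{s-2,k},\,p_{s-1}-1,\dots,p_{\ell-1}-1)$. Such ideals exist. Finally $K:=I\sqcup\{\epsilon_k\mid1\le k\le\ell\}$, which is an ideal of $\Phi^+(B_\ell)$. *)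

theory Defs
  imports Complex_Main "HOL-Library.FuncSet" "HOL-Library.Function_Algebras"
begin

text \<open>
  Every vector that occurs is an integral combination of the orthonormal vectors
  \<open>\<epsilon>\<^sub>1, \<epsilon>\<^sub>2, \<dots>\<close>; it is represented by its coordinate function, with coordinates
  numbered from 1. Addition and subtraction of vectors are pointwise.
\<close>

type_synonym vec = "nat \<Rightarrow> int"

definition eps :: "nat \<Rightarrow> vec" where
  "eps i = (\<lambda>j. if j = i then 1 else 0)"

definition pos_roots_B :: "nat \<Rightarrow> vec set" where
  "pos_roots_B n =
     {eps i | i. 1 \<le> i \<and> i \<le> n}
     \<union> {eps i + eps j | i j. 1 \<le> i \<and> i < j \<and> j \<le> n}
     \<union> {eps i - eps j | i j. 1 \<le> i \<and> i < j \<and> j \<le> n}"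

definition simple_root_B :: "nat \<Rightarrow> nat \<Rightarrow> vec" where
  "simple_root_B n i = (if i = n then eps n else eps i - eps (i + 1))"

definition pos_roots_D :: "nat \<Rightarrow> vec set" where
  "pos_roots_D l =
     {eps i + eps j | i j. 1 \<le> i \<and> i < j \<and> j \<le> l}
     \<union> {eps i - eps j | i j. 1 \<le> i \<and> i < j \<and> j \<le> l}"

definition simple_root_D :: "nat \<Rightarrow> nat \<Rightarrow> vec" where
  "simple_root_D l i = (if i = l then eps (l - 1) + eps l else eps i - eps (i + 1))"

text \<open>In the next three definitions \<open>\<alpha> 1, \<dots>, \<alpha> n\<close> are the simple roots.\<close>

definition root_ge :: "nat \<Rightarrow> (nat \<Rightarrow> vec) \<Rightarrow> vec \<Rightarrow> vec \<Rightarrow> bool" where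
  "root_ge n \<alpha> \<beta>\<^sub>1 \<beta>\<^sub>2 \<longleftrightarrow>
     (\<exists>c :: nat \<Rightarrow> nat. \<beta>\<^sub>1 - \<beta>\<^sub>2 = (\<lambda>j. \<Sum>i = 1..n. int (c i) * \<alpha> i j))"

definition root_ideal :: "nat \<Rightarrow> (nat \<Rightarrow> vec) \<Rightarrow> vec set \<Rightarrow> vec set \<Rightarrow> bool" where
  "root_ideal n \<alpha> \<Phi> I \<longleftrightarrow>
     I \<subseteq> \<Phi> \<and> (\<forall>\<beta>\<^sub>1\<in>I. \<forall>\<beta>\<^sub>2\<in>\<Phi>. root_ge n \<alpha> \<beta>\<^sub>1 \<beta>\<^sub>2 \<longrightarrow> \<beta>\<^sub>2 \<in> I)"

definition simple_coords :: "nat \<Rightarrow> (nat \<Rightarrow> vec) \<Rightarrow> vec \<Rightarrow> (nat \<Rightarrow> int)" where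
  "simple_coords n \<alpha> \<beta> =
     (THE c. (\<forall>i. i \<notin> {1..n} \<longrightarrow> c i = 0) \<and> \<beta> = (\<lambda>j. \<Sum>i = 1..n. c i * \<alpha> i j))"

abbreviation ideal_B :: "nat \<Rightarrow> vec set \<Rightarrow> bool" where
  "ideal_B n I \<equiv> root_ideal n (simple_root_B n) (pos_roots_B n) I"

abbreviation ideal_D :: "nat \<Rightarrow> vec set \<Rightarrow> bool" where
  "ideal_D l I \<equiv> root_ideal l (simple_root_D l) (pos_roots_D l) I"

text \<open>
  The columns of the matrices \<open>T\<^sub>\<Psi>\<close> and \<open>S\<^sub>\<Psi>\<close> are indexed by the elements of \<open>\<Psi>\<close> themselves,
  and their rows by \<open>{1..n}\<close>. An element of \<open>(\<int>/q\<int>)\<^sup>n\<close> is given by its representatives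
  in \<open>{0..<q}\<close>. The root system enters the characteristic quasi-polynomial only through its
  rank \<open>n\<close> (and through the matrix).
\<close>

definition T_matrix :: "nat \<Rightarrow> vec \<Rightarrow> int" where
  "T_matrix i \<beta> = \<beta> i"

definition S_matrix :: "nat \<Rightarrow> (nat \<Rightarrow> vec) \<Rightarrow> nat \<Rightarrow> vec \<Rightarrow> int" where
  "S_matrix n \<alpha> i \<beta> = simple_coords n \<alpha> \<beta> i"

definition chi_quasi :: "nat \<Rightarrow> (nat \<Rightarrow> vec \<Rightarrow> int) \<Rightarrow> vec set \<Rightarrow> nat \<Rightarrow> nat" where
  "chi_quasi n M \<Psi> q =
     card {z \<in> {1..n} \<rightarrow>\<^sub>E {0..<int q}. \<forall>\<beta>\<in>\<Psi>. (\<Sum>i = 1..n. z i * M i \<beta>) mod int q \<noteq> 0}"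

definition SG :: "nat \<Rightarrow> vec set \<Rightarrow> nat \<Rightarrow> nat" where
  "SG n \<Psi> i =
     card {j. i < j \<and> j \<le> n \<and> eps i + eps j \<in> \<Psi>}
     + card {j. i < j \<and> j \<le> n \<and> eps i - eps j \<in> \<Psi>}
     + card ({eps i} \<inter> \<Psi>)"

definition s_index :: "nat \<Rightarrow> vec set \<Rightarrow> nat" where
  "s_index l I = Min {k. 2 \<le> k \<and> k \<le> l \<and> eps (k - 1) + eps k \<in> I}"

definition tau :: "vec set \<Rightarrow> nat \<Rightarrow> nat \<Rightarrow> int" where
  "tau I n k = (if eps n + eps k \<in> I then 1 else 0)"

text \<open>The \<open>i\<close>-th entry (\<open>1 \<le> i \<le> l - 1\<close>) of the sequence prescribed for \<open>\<S>\<G>(U\<^sub>k)\<close>.\<close>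

definition SG_U :: "nat \<Rightarrow> vec set \<Rightarrow> nat \<Rightarrow> nat \<Rightarrow> int" where
  "SG_U l I k i =
     (if k + 2 \<le> s_index l I
      then (if i < k then int (SG l I i) else int (SG l I (i + 1)) + 1)
      else (if i + 2 \<le> s_index l I then int (SG l I i) - tau I i k else int (SG l I i) - 1))"

definition U_ideal :: "nat \<Rightarrow> vec set \<Rightarrow> nat \<Rightarrow> vec set" where
  "U_ideal l I k =
     (THE U. ideal_B (l - 1) U \<and> (\<forall>i\<in>{1..l - 1}. int (SG (l - 1) U i) = SG_U l I k i))"

definition K_ideal :: "nat \<Rightarrow> vec set \<Rightarrow> vec set" where
  "K_ideal l I = I \<union> eps ` {1..l}"

end

theory Submission
  imports Defs
begin

text \<open>
  A point counted by the matrix \<open>S\<close> is a homomorphism from the root lattice of type \<open>D\<close> to the residues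
  modulo \<open>q\<close>, given by its values on the simple roots. The root lattice has index 2 in the lattice spanned by
  \<open>\<epsilon>\<^sub>1, \<dots>, \<epsilon>\<^sub>l\<close>, so a homomorphism need not extend to the \<open>\<epsilon>\<^sub>i\<close>; but doubled values \<open>w\<^sub>i\<close> at the \<open>\<epsilon>\<^sub>i\<close>
  exist modulo \<open>2 q\<close>. They all have the same parity, and exactly two choices of \<open>w\<close>, differing by \<open>q\<close> in every
  coordinate, belong to a given homomorphism. Hence twice the left-hand side counts the points \<open>w\<close> modulo \<open>2 q\<close>
  with coordinates of equal parity whose pairing with every root of \<open>I\<close> is nonzero
  (\<open>twice_chi_quasi_S_matrix_D\<close>).

  If all \<open>w\<^sub>i\<close> are odd, then \<open>w\<^sub>i\<close> and \<open>- w\<^sub>i\<close> are always different, because \<open>q\<close> is even. Choosing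
  \<open>w\<^sub>l, \<dots>, w\<^sub>1\<close> in this order, the ideal property makes the \<open>p\<^sub>i\<close> values forbidden for \<open>w\<^sub>i\<close> distinct, which
  gives the product of the \<open>q - p\<^sub>i\<close> (\<open>card_signed_injections\<close>, \<open>card_odd_points\<close>).

  If all \<open>w\<^sub>i\<close> are even, then \<open>w = 2 x\<close> for a point \<open>x\<close> counted by the matrix \<open>T\<close> of \<open>I\<close>. Since
  \<open>\<epsilon>\<^sub>1 - \<epsilon>\<^sub>l\<close> lies in \<open>I\<close>, so do all differences \<open>\<epsilon>\<^sub>i - \<epsilon>\<^sub>j\<close>; the coordinates of \<open>x\<close> are distinct and at most
  one of them is zero. The points without a zero coordinate are those counted for \<open>K\<close>. If \<open>x\<^sub>k = 0\<close>, deleting this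
  coordinate leaves a point with nonzero coordinates that avoids the roots of \<open>I\<close> not involving the index \<open>k\<close>
  (\<open>chi_quasi_long_roots_split\<close>). These roots, reindexed and joined with the short roots, form an ideal of type
  \<open>B\<close> whose row lengths are the ones prescribed for \<open>U\<^sub>k\<close> (\<open>SG_U_long_roots\<close>). As each row of positive roots is a
  chain, an ideal of type \<open>B\<close> is determined by its row lengths (\<open>ideal_B_eqI\<close>), so it is \<open>U\<^sub>k\<close>.
\<close>


section \<open>Pairing vectors with points\<close>

definition pairing :: "nat \<Rightarrow> vec \<Rightarrow> vec \<Rightarrow> int" where
  "pairing n z v = (\<Sum>i = 1..n. z i * v i)"

lemma pairing_add: "pairing n z (u + v) = pairing n z u + pairing n z v"
  by (simp add: pairing_def algebra_simps sum.distrib)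

lemma pairing_diff: "pairing n z (u - v) = pairing n z u - pairing n z v"
  by (simp add: pairing_def algebra_simps sum_subtractf)

lemma pairing_eps: "a \<in> {1..n} \<Longrightarrow> pairing n z (eps a) = z a"
  by (simp add: pairing_def eps_def if_distrib [of "\<lambda>x. _ * x"] cong: if_cong)

lemmas pairing_simps = pairing_add pairing_diff pairing_eps

lemma pairing_combination:
  "pairing n z (\<lambda>j. \<Sum>i = 1..n. c i * \<alpha> i j) = (\<Sum>i = 1..n. c i * pairing n z (\<alpha> i))"
proof -
  have "pairing n z (\<lambda>j. \<Sum>i = 1..n. c i * \<alpha> i j) = (\<Sum>j = 1..n. \<Sum>i = 1..n. z j * (c i * \<alpha> i j))"
    by (simp add: pairing_def sum_distrib_left)
  also have "\<dots> = (\<Sum>i = 1..n. \<Sum>j = 1..n. z j * (c i * \<alpha> i j))"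
    by (rule sum.swap)
  also have "\<dots> = (\<Sum>i = 1..n. c i * pairing n z (\<alpha> i))"
    by (simp add: pairing_def sum_distrib_left mult.left_commute)
  finally show ?thesis .
qed

definition avoids :: "nat \<Rightarrow> int \<Rightarrow> vec set \<Rightarrow> vec \<Rightarrow> bool" where
  "avoids n m \<Psi> z \<longleftrightarrow> (\<forall>\<beta>\<in>\<Psi>. pairing n z \<beta> mod m \<noteq> 0)"

lemma chi_quasi_T_matrix:
  "chi_quasi n T_matrix \<Psi> q = card {z \<in> {1..n} \<rightarrow>\<^sub>E {0..<int q}. avoids n (int q) \<Psi> z}"
  by (simp add: chi_quasi_def T_matrix_def avoids_def pairing_def)


section \<open>Nonnegative combinations of simple roots\<close>

definition root_cone :: "nat \<Rightarrow> (nat \<Rightarrow> vec) \<Rightarrow> vec set" where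
  "root_cone n \<alpha> = {v. \<exists>c :: nat \<Rightarrow> nat. v = (\<lambda>j. \<Sum>i = 1..n. int (c i) * \<alpha> i j)}"

lemma root_ge_iff: "root_ge n \<alpha> \<beta> \<gamma> \<longleftrightarrow> \<beta> - \<gamma> \<in> root_cone n \<alpha>"
  by (simp add: root_ge_def root_cone_def)

lemma root_cone_add:
  assumes "u \<in> root_cone n \<alpha>" "v \<in> root_cone n \<alpha>"
  shows "u + v \<in> root_cone n \<alpha>"
proof -
  obtain c d :: "nat \<Rightarrow> nat" where
    "u = (\<lambda>j. \<Sum>i = 1..n. int (c i) * \<alpha> i j)" "v = (\<lambda>j. \<Sum>i = 1..n. int (d i) * \<alpha> i j)"
    using assms by (auto simp: root_cone_def)
  then have "u + v = (\<lambda>j. \<Sum>i = 1..n. int (c i + d i) * \<alpha> i j)"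
    by (auto simp: fun_eq_iff sum.distrib algebra_simps)
  then show ?thesis
    unfolding root_cone_def by (intro CollectI exI [of _ "\<lambda>i. c i + d i"])
qed

lemma root_cone_zero: "0 \<in> root_cone n \<alpha>"
  unfolding root_cone_def by (intro CollectI exI [of _ "\<lambda>_. 0"]) (auto simp: fun_eq_iff)

lemma root_cone_simple:
  assumes "i \<in> {1..n}"
  shows "\<alpha> i \<in> root_cone n \<alpha>"
  unfolding root_cone_def using assms
  by (intro CollectI exI [of _ "\<lambda>k. if k = i then 1 else 0"])
     (auto simp: fun_eq_iff if_distrib [of int] if_distrib [of "\<lambda>x. x * _"] cong: if_cong)

text \<open>
  The difference telescopes into consecutive simple roots, which types \<open>B\<close> and \<open>D\<close> share.
\<close>

lemma eps_diff_in_root_cone: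
  assumes \<alpha>: "\<And>i. 1 \<le> i \<Longrightarrow> i < n \<Longrightarrow> \<alpha> i = eps i - eps (i + 1)"
    and "1 \<le> i" "i \<le> j" "j \<le> n"
  shows "eps i - eps j \<in> root_cone n \<alpha>"
  using \<open>i \<le> j\<close> \<open>j \<le> n\<close>
proof (induction rule: dec_induct)
  case base
  show ?case unfolding diff_self by (rule root_cone_zero)
next
  case (step k)
  have "\<alpha> k \<in> root_cone n \<alpha>"
    using step assms(2) by (intro root_cone_simple) auto
  moreover have "\<alpha> k = eps k - eps (k + 1)"
    using step assms(2) by (intro \<alpha>) auto
  ultimately have "(eps i - eps k) + (eps k - eps (k + 1)) \<in> root_cone n \<alpha>"
    using step.IH step.prems by (intro root_cone_add) (simp_all only: Suc_leD Suc_eq_plus1 [symmetric])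
  then show ?case by (simp add: fun_diff_def plus_fun_def)
qed

lemma eps_diff_in_cone_B:
  "\<lbrakk>1 \<le> i; i \<le> j; j \<le> n\<rbrakk> \<Longrightarrow> eps i - eps j \<in> root_cone n (simple_root_B n)"
  by (rule eps_diff_in_root_cone) (auto simp: simple_root_B_def)

lemma eps_in_cone_B:
  assumes "1 \<le> i" "i \<le> n"
  shows "eps i \<in> root_cone n (simple_root_B n)"
proof -
  have "simple_root_B n n \<in> root_cone n (simple_root_B n)"
    using assms by (intro root_cone_simple) auto
  then have "(eps i - eps n) + eps n \<in> root_cone n (simple_root_B n)"
    using assms by (intro root_cone_add eps_diff_in_cone_B) (auto simp: simple_root_B_def)
  then show ?thesis by simp
qed

lemma eps_diff_in_cone_D:
  "\<lbrakk>1 \<le> i; i \<le> j; j \<le> n\<rbrakk> \<Longrightarrow> eps i - eps j \<in> root_cone n (simple_root_D n)"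
  by (rule eps_diff_in_root_cone) (auto simp: simple_root_D_def)

lemma eps_sum_in_cone_D:
  assumes "1 \<le> i" "i < j" "j \<le> n"
  shows "eps i + eps j \<in> root_cone n (simple_root_D n)"
proof -
  have "simple_root_D n n \<in> root_cone n (simple_root_D n)"
    using assms by (intro root_cone_simple) auto
  then have "(eps i - eps (n - 1)) + ((eps j - eps n) + (eps (n - 1) + eps n))
      \<in> root_cone n (simple_root_D n)"
    using assms
    by (intro root_cone_add [OF eps_diff_in_cone_D] root_cone_add [OF eps_diff_in_cone_D])
       (auto simp: simple_root_D_def)
  then show ?thesis by (simp add: algebra_simps)
qed

lemma sum_eps: "sum (eps i) {Suc 0..m} = (if 1 \<le> i \<and> i \<le> m then 1 else 0)"
  by (auto simp: eps_def)

text \<open>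
  Every simple root of type \<open>B\<close> has nonnegative partial sums of coordinates. These necessary conditions
  are all that is used to refute comparabilities between positive roots.
\<close>

lemma root_cone_B_partial_sum_nonneg:
  assumes "v \<in> root_cone n (simple_root_B n)" "m \<le> n"
  shows "0 \<le> (\<Sum>j = 1..m. v j)"
proof -
  obtain c :: "nat \<Rightarrow> nat" where c: "v = (\<lambda>j. \<Sum>i = 1..n. int (c i) * simple_root_B n i j)"
    using assms by (auto simp: root_cone_def)
  have "0 \<le> (\<Sum>j = 1..m. simple_root_B n i j)" if "i \<in> {1..n}" for i
    using that by (auto simp: simple_root_B_def sum_subtractf sum_eps)
  then have "0 \<le> int (c i) * (\<Sum>j = 1..m. simple_root_B n i j)" if "i \<in> {1..n}" for i
    using that by (intro mult_nonneg_nonneg) auto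
  then have "0 \<le> (\<Sum>i = 1..n. int (c i) * (\<Sum>j = 1..m. simple_root_B n i j))"
    by (rule sum_nonneg)
  also have "\<dots> = (\<Sum>j = 1..m. v j)"
    unfolding c sum_distrib_left by (rule sum.swap)
  finally show ?thesis .
qed


section \<open>Ideals of type B are determined by their row lengths\<close>

lemma eps_root_eq_iffs:
  "eps j \<noteq> 0"
  "eps i = eps j \<longleftrightarrow> i = j"
  "i < j \<Longrightarrow> a < b \<Longrightarrow> eps i + eps j = eps a + eps b \<longleftrightarrow> i = a \<and> j = b"
  "i < j \<Longrightarrow> a < b \<Longrightarrow> eps i - eps j = eps a - eps b \<longleftrightarrow> i = a \<and> j = b"
  "i < j \<Longrightarrow> eps i + eps j \<noteq> eps a"
  "i < j \<Longrightarrow> eps i - eps j \<noteq> eps a"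
  "i < j \<Longrightarrow> eps i + eps j \<noteq> eps a - eps b"
proof -
  show "eps j \<noteq> 0"
    by (auto simp: eps_def fun_eq_iff)
  show "eps i = eps j \<longleftrightarrow> i = j"
    by (auto simp: eps_def fun_eq_iff split: if_splits)
  show "i < j \<Longrightarrow> a < b \<Longrightarrow> eps i + eps j = eps a + eps b \<longleftrightarrow> i = a \<and> j = b"
    unfolding fun_eq_iff eps_def plus_fun_def
    by (rule iffI, frule spec [of _ i], frule spec [of _ j], frule spec [of _ a], frule spec [of _ b])
       (auto split: if_splits)
  show "i < j \<Longrightarrow> a < b \<Longrightarrow> eps i - eps j = eps a - eps b \<longleftrightarrow> i = a \<and> j = b"
    unfolding fun_eq_iff eps_def fun_diff_def
    by (rule iffI, frule spec [of _ i], frule spec [of _ j]) (auto split: if_splits)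
  show "i < j \<Longrightarrow> eps i + eps j \<noteq> eps a"
    unfolding fun_eq_iff eps_def plus_fun_def
    by (rule notI, frule spec [of _ i], frule spec [of _ j]) (auto split: if_splits)
  show "i < j \<Longrightarrow> eps i - eps j \<noteq> eps a"
    unfolding fun_eq_iff eps_def fun_diff_def
    by (rule notI, frule spec [of _ i], frule spec [of _ j]) (auto split: if_splits)
  show "i < j \<Longrightarrow> eps i + eps j \<noteq> eps a - eps b"
    unfolding fun_eq_iff eps_def fun_diff_def plus_fun_def
    by (rule notI, frule spec [of _ i], frule spec [of _ j]) (auto split: if_splits)
qed

text \<open>
  The positive roots of type \<open>B\<close> whose leading coordinate has index \<open>i\<close>; \<open>SG\<close> counts their members in a set.
\<close>

definition row :: "nat \<Rightarrow> nat \<Rightarrow> vec set" where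
  "row n i = {eps i} \<union> (\<lambda>j. eps i + eps j) ` {i<..n} \<union> (\<lambda>j. eps i - eps j) ` {i<..n}"

lemma finite_row: "finite (row n i)"
  by (simp add: row_def)

lemma in_row_iff:
  "v \<in> row n i \<longleftrightarrow> v = eps i \<or> (\<exists>j. i < j \<and> j \<le> n \<and> (v = eps i + eps j \<or> v = eps i - eps j))"
  by (auto simp: row_def)

lemma pos_roots_B_eq_rows: "pos_roots_B n = (\<Union>i\<in>{1..n}. row n i)"
proof (intro equalityI subsetI)
  fix v
  assume "v \<in> pos_roots_B n"
  then consider i where "1 \<le> i" "i \<le> n" "v = eps i"
    | i j where "1 \<le> i" "i < j" "j \<le> n" "v = eps i + eps j \<or> v = eps i - eps j"
    unfolding pos_roots_B_def by auto
  then show "v \<in> (\<Union>i\<in>{1..n}. row n i)"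
  proof cases
    case (1 i)
    then show ?thesis by (intro UN_I [of i]) (simp_all add: row_def)
  next
    case (2 i j)
    then show ?thesis by (intro UN_I [of i]) (auto simp: row_def)
  qed
next
  fix v
  assume "v \<in> (\<Union>i\<in>{1..n}. row n i)"
  then obtain i where "1 \<le> i" "i \<le> n" "v \<in> row n i" by auto
  then show "v \<in> pos_roots_B n"
    unfolding in_row_iff pos_roots_B_def Un_iff mem_Collect_eq by (elim disjE exE conjE) auto
qed

lemma SG_eq_card_row: "SG n U i = card (U \<inter> row n i)"
proof -
  let ?P = "{j. i < j \<and> j \<le> n \<and> eps i + eps j \<in> U}"
  let ?M = "{j. i < j \<and> j \<le> n \<and> eps i - eps j \<in> U}"
  have fin: "finite ?P" "finite ?M"
    by (auto intro: finite_subset [of _ "{..n}"])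
  have fin': "finite ((\<lambda>j. eps i + eps j) ` ?P)" "finite ((\<lambda>j. eps i - eps j) ` ?M)"
    using fin by (auto intro: finite_imageI)
  have plus: "card ((\<lambda>j. eps i + eps j) ` ?P) = card ?P"
    by (rule card_image) (simp add: inj_on_def eps_root_eq_iffs)
  have minus: "card ((\<lambda>j. eps i - eps j) ` ?M) = card ?M"
    by (rule card_image) (simp add: inj_on_def eps_root_eq_iffs)
  have disjoint: "(\<lambda>j. eps i + eps j) ` ?P \<inter> (\<lambda>j. eps i - eps j) ` ?M = {}"
    using eps_root_eq_iffs(7) by (auto simp only: disjoint_iff)
  have disjoint': "((\<lambda>j. eps i + eps j) ` ?P \<union> (\<lambda>j. eps i - eps j) ` ?M) \<inter> ({eps i} \<inter> U) = {}"
    using eps_root_eq_iffs(5,6) [THEN not_sym] by (auto simp only: disjoint_iff)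
  have "U \<inter> row n i = ((\<lambda>j. eps i + eps j) ` ?P \<union> (\<lambda>j. eps i - eps j) ` ?M) \<union> ({eps i} \<inter> U)"
    unfolding row_def by (intro equalityI subsetI) auto
  moreover have "finite ({eps i} \<inter> U)"
    by simp
  ultimately have "card (U \<inter> row n i) = card ?P + card ?M + card ({eps i} \<inter> U)"
    using card_Un_disjoint [OF finite_UnI [OF fin'] _ disjoint'] card_Un_disjoint [OF fin' disjoint]
    unfolding plus minus by simp
  then show ?thesis
    unfolding SG_def by (rule sym)
qed

text \<open>
  A root in row \<open>i\<close> is \<open>\<epsilon>\<^sub>i - v\<close> with \<open>v\<close> one of
  \<open>\<epsilon>\<^sub>i\<^sub>+\<^sub>1 \<succ> \<dots> \<succ> \<epsilon>\<^sub>n \<succ> 0 \<succ> -\<epsilon>\<^sub>n \<succ> \<dots> \<succ> -\<epsilon>\<^sub>i\<^sub>+\<^sub>1\<close>, and these vectors form a chain.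
\<close>

lemma row_comparable:
  assumes "1 \<le> i" "i \<le> n" "\<beta> \<in> row n i" "\<gamma> \<in> row n i"
  shows "root_ge n (simple_root_B n) \<beta> \<gamma> \<or> root_ge n (simple_root_B n) \<gamma> \<beta>"
proof -
  define C where "C = root_cone n (simple_root_B n)"
  have d: "eps j - eps k \<in> C" if "i \<le> j" "j \<le> k" "k \<le> n" for j k
    using that assms unfolding C_def by (intro eps_diff_in_cone_B) auto
  have e: "eps j \<in> C" if "i \<le> j" "j \<le> n" for j
    using that assms unfolding C_def by (intro eps_in_cone_B) auto
  have s: "eps j + eps k \<in> C" if "i \<le> j" "j \<le> n" "i \<le> k" "k \<le> n" for j k
    using that e unfolding C_def by (intro root_cone_add) auto
  have z: "0 \<in> C"
    unfolding C_def by (rule root_cone_zero)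
  have diffs: "eps i + eps j - eps i = eps j" "eps i - (eps i - eps j) = eps j"
    "eps i + eps j - (eps i + eps k) = eps j - eps k"
    "eps i - eps j - (eps i - eps k) = eps k - eps j"
    "eps i + eps j - (eps i - eps k) = eps j + eps k" for j k
    by simp_all
  have dd: "eps j - eps k \<in> C \<or> eps k - eps j \<in> C" if "i < j" "j \<le> n" "i < k" "k \<le> n" for j k
    using that by (meson d less_imp_le nat_le_linear)
  have "\<beta> - \<gamma> \<in> C \<or> \<gamma> - \<beta> \<in> C"
    using assms(3) [unfolded in_row_iff]
  proof (elim disjE exE conjE)
    assume \<beta>: "\<beta> = eps i"
    show ?thesis
      using assms(4) [unfolded in_row_iff]
    proof (elim disjE exE conjE)
      assume \<gamma>: "\<gamma> = eps i"
      show ?thesis unfolding \<beta> \<gamma> diff_self using z by blast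
    next
      fix k assume \<gamma>: "i < k" "k \<le> n" "\<gamma> = eps i + eps k"
      show ?thesis unfolding \<beta> \<gamma> diffs using e [of k] \<gamma> by auto
    next
      fix k assume \<gamma>: "i < k" "k \<le> n" "\<gamma> = eps i - eps k"
      show ?thesis unfolding \<beta> \<gamma> diffs using e [of k] \<gamma> by auto
    qed
  next
    fix j assume \<beta>: "i < j" "j \<le> n" "\<beta> = eps i + eps j"
    show ?thesis
      using assms(4) [unfolded in_row_iff]
    proof (elim disjE exE conjE)
      assume \<gamma>: "\<gamma> = eps i"
      show ?thesis unfolding \<beta> \<gamma> diffs using e [of j] \<beta> by auto
    next
      fix k assume \<gamma>: "i < k" "k \<le> n" "\<gamma> = eps i + eps k"
      show ?thesis unfolding \<beta> \<gamma> diffs by (rule dd) fact+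
    next
      fix k assume \<gamma>: "i < k" "k \<le> n" "\<gamma> = eps i - eps k"
      show ?thesis unfolding \<beta> \<gamma> diffs using s [of j k] \<beta> \<gamma> by auto
    qed
  next
    fix j assume \<beta>: "i < j" "j \<le> n" "\<beta> = eps i - eps j"
    show ?thesis
      using assms(4) [unfolded in_row_iff]
    proof (elim disjE exE conjE)
      assume \<gamma>: "\<gamma> = eps i"
      show ?thesis unfolding \<beta> \<gamma> diffs using e [of j] \<beta> by auto
    next
      fix k assume \<gamma>: "i < k" "k \<le> n" "\<gamma> = eps i + eps k"
      show ?thesis unfolding \<beta> \<gamma> diffs using s [of k j] \<beta> \<gamma> by auto
    next
      fix k assume \<gamma>: "i < k" "k \<le> n" "\<gamma> = eps i - eps k"
      show ?thesis unfolding \<beta> \<gamma> diffs using dd [OF \<beta>(1,2) \<gamma>(1,2)] by blast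
    qed
  qed
  then show ?thesis by (simp add: root_ge_iff C_def)
qed

text \<open>
  On each row, two ideals cut out lower sets of the same chain. Such sets are nested, so they agree once
  their cardinalities do.
\<close>

lemma ideal_B_eqI:
  assumes U: "ideal_B n U" and U': "ideal_B n U'"
    and SG: "\<And>i. i \<in> {1..n} \<Longrightarrow> SG n U i = SG n U' i"
  shows "U = U'"
proof -
  have "U \<inter> row n i = U' \<inter> row n i" if i: "i \<in> {1..n}" for i
  proof -
    have row: "row n i \<subseteq> pos_roots_B n"
      using i by (auto simp: pos_roots_B_eq_rows)
    have card: "card (U \<inter> row n i) = card (U' \<inter> row n i)"
      using SG [OF i] by (simp add: SG_eq_card_row)
    have "U \<inter> row n i \<subseteq> U' \<inter> row n i \<or> U' \<inter> row n i \<subseteq> U \<inter> row n i"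
    proof (rule ccontr)
      assume "\<not> ?thesis"
      then obtain \<beta> \<gamma> where "\<beta> \<in> U" "\<beta> \<notin> U'" "\<gamma> \<in> U'" "\<gamma> \<notin> U" "\<beta> \<in> row n i" "\<gamma> \<in> row n i"
        by blast
      moreover from this have "root_ge n (simple_root_B n) \<beta> \<gamma> \<or> root_ge n (simple_root_B n) \<gamma> \<beta>"
        using i by (intro row_comparable) auto
      ultimately show False
        using U U' row unfolding root_ideal_def by blast
    qed
    then show ?thesis
      using card card_subset_eq finite_row finite_Int by (metis (no_types, lifting))
  qed
  moreover have "U \<subseteq> pos_roots_B n" "U' \<subseteq> pos_roots_B n"
    using U U' by (auto simp: root_ideal_def)
  ultimately show ?thesis
    unfolding pos_roots_B_eq_rows by blast
qed


section \<open>Ideals containing all differences\<close>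

text \<open>
  For an ideal of type \<open>D\<close> containing \<open>\<epsilon>\<^sub>1 - \<epsilon>\<^sub>l\<close>, all differences belong to it, and only the sums
  \<open>\<epsilon>\<^sub>i + \<epsilon>\<^sub>j\<close> carry information. The relation \<open>P\<close> records which of them are present. All ideals of both
  types that matter here have this shape, up to adjoining the short roots.
\<close>

definition long_roots :: "nat \<Rightarrow> (nat \<Rightarrow> nat \<Rightarrow> bool) \<Rightarrow> vec set" where
  "long_roots n P = {eps i - eps j | i j. 1 \<le> i \<and> i < j \<and> j \<le> n}
     \<union> {eps i + eps j | i j. 1 \<le> i \<and> i < j \<and> j \<le> n \<and> P i j}"

text \<open>
  This is the trace of the ideal condition on \<open>P\<close>: a sum of two coordinate vectors becomes smaller
  when its indices grow.
\<close>

definition up_closed :: "nat \<Rightarrow> (nat \<Rightarrow> nat \<Rightarrow> bool) \<Rightarrow> bool" where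
  "up_closed n P \<longleftrightarrow>
     (\<forall>i j a b. P i j \<and> 1 \<le> i \<and> i < j \<and> i \<le> a \<and> j \<le> b \<and> a < b \<and> b \<le> n \<longrightarrow> P a b)"

lemma up_closedD:
  "\<lbrakk>up_closed n P; P i j; 1 \<le> i; i < j; i \<le> a; j \<le> b; a < b; b \<le> n\<rbrakk> \<Longrightarrow> P a b"
  unfolding up_closed_def by blast

text \<open>
  Only sums can fail to lie in the set, and by partial sums of coordinates a root above a sum is
  itself a sum with smaller indices.
\<close>

lemma ideal_B_long_roots:
  assumes P: "up_closed n P"
  shows "ideal_B n (long_roots n P \<union> eps ` {1..n})"
  unfolding root_ideal_def
proof (intro conjI ballI impI)
  show "long_roots n P \<union> eps ` {1..n} \<subseteq> pos_roots_B n"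
    by (auto simp: long_roots_def pos_roots_B_def)
  fix \<beta> \<gamma>
  assume \<beta>: "\<beta> \<in> long_roots n P \<union> eps ` {1..n}" and \<gamma>: "\<gamma> \<in> pos_roots_B n"
    and "root_ge n (simple_root_B n) \<beta> \<gamma>"
  then have cone: "0 \<le> (\<Sum>k = 1..m. (\<beta> - \<gamma>) k)" if "m \<le> n" for m
    using root_cone_B_partial_sum_nonneg that unfolding root_ge_iff by blast
  show "\<gamma> \<in> long_roots n P \<union> eps ` {1..n}"
  proof (cases "\<exists>a b. \<gamma> = eps a + eps b \<and> 1 \<le> a \<and> a < b \<and> b \<le> n")
    case False
    then show ?thesis using \<gamma> by (auto simp: long_roots_def pos_roots_B_def)
  next
    case True
    then obtain a b where ab: "\<gamma> = eps a + eps b" "1 \<le> a" "a < b" "b \<le> n" by blast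
    \<comment> \<open>The total coordinate sum is 2 for a sum, 1 for a short root and 0 for a difference.\<close>
    have "2 \<le> (\<Sum>k = 1..n. \<beta> k)"
      using cone [of n] ab by (simp add: sum_subtractf sum.distrib sum_eps)
    then have "\<not> (\<exists>i. \<beta> = eps i)" "\<not> (\<exists>i j. \<beta> = eps i - eps j \<and> 1 \<le> i \<and> i < j \<and> j \<le> n)"
      by (auto simp: sum_subtractf sum_eps split: if_splits)
    then obtain i j where ij: "\<beta> = eps i + eps j" "1 \<le> i" "i < j" "j \<le> n" "P i j"
      using \<beta> by (auto simp: long_roots_def)
    \<comment> \<open>Partial sums up to \<open>a\<close> and up to \<open>b\<close> compare the smaller and the larger indices.\<close>
    have "i \<le> a"
      using cone [of a] ab ij by (auto simp: sum_subtractf sum.distrib sum_eps split: if_splits)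
    moreover have "j \<le> b"
      using cone [of b] ab ij by (auto simp: sum_subtractf sum.distrib sum_eps split: if_splits)
    ultimately have "P a b"
      using P ij ab unfolding up_closed_def by blast
    then show ?thesis using ab by (auto simp: long_roots_def)
  qed
qed

lemma eps_sum_in_long_roots:
  "\<lbrakk>1 \<le> i; i < j; j \<le> n\<rbrakk> \<Longrightarrow> eps i + eps j \<in> long_roots n P \<longleftrightarrow> P i j"
  by (auto simp: long_roots_def eps_root_eq_iffs)

lemma eps_diff_in_long_roots:
  "\<lbrakk>1 \<le> i; i < j; j \<le> n\<rbrakk> \<Longrightarrow> eps i - eps j \<in> long_roots n P"
  by (auto simp: long_roots_def)

lemma eps_notin_long_roots: "eps i \<notin> long_roots n P"
  by (auto simp: long_roots_def eps_root_eq_iffs dest: sym)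

definition row_sums :: "nat \<Rightarrow> (nat \<Rightarrow> nat \<Rightarrow> bool) \<Rightarrow> nat \<Rightarrow> nat set" where
  "row_sums n P i = {j. i < j \<and> j \<le> n \<and> P i j}"

lemma finite_row_sums: "finite (row_sums n P i)"
  by (auto simp: row_sums_def intro: finite_subset [of _ "{..n}"])

lemma SG_long_roots:
  assumes "i \<in> {1..n}"
  shows "SG n (long_roots n P) i = card (row_sums n P i) + (n - i)"
proof -
  have "{j. i < j \<and> j \<le> n \<and> eps i + eps j \<in> long_roots n P} = row_sums n P i"
    using assms by (auto simp: row_sums_def eps_sum_in_long_roots)
  moreover have "{j. i < j \<and> j \<le> n \<and> eps i - eps j \<in> long_roots n P} = {i<..n}"
    using assms by (auto simp: eps_diff_in_long_roots)
  ultimately show ?thesis by (simp add: SG_def eps_notin_long_roots)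
qed

lemma SG_long_roots_eps:
  assumes "i \<in> {1..n}"
  shows "SG n (long_roots n P \<union> eps ` {1..n}) i = card (row_sums n P i) + (n - i) + 1"
proof -
  have "{j. i < j \<and> j \<le> n \<and> eps i + eps j \<in> long_roots n P \<union> eps ` {1..n}} = row_sums n P i"
    using assms by (auto simp: row_sums_def eps_sum_in_long_roots eps_root_eq_iffs)
  moreover have "{j. i < j \<and> j \<le> n \<and> eps i - eps j \<in> long_roots n P \<union> eps ` {1..n}} = {i<..n}"
    using assms by (auto simp: eps_diff_in_long_roots)
  moreover have "{eps i} \<inter> (long_roots n P \<union> eps ` {1..n}) = {eps i}"
    using assms by auto
  ultimately show ?thesis by (simp add: SG_def)
qed

lemma ball_family_iff: "(\<forall>x\<in>{f i j | i j. Q i j}. R x) \<longleftrightarrow> (\<forall>i j. Q i j \<longrightarrow> R (f i j))"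
  by blast

text \<open>
  The conditions that the two roots with indices \<open>i\<close> and \<open>j\<close> impose on a point; for roots of this form the
  pairing no longer depends on the ambient rank.
\<close>

definition separated :: "int \<Rightarrow> (nat \<Rightarrow> nat \<Rightarrow> bool) \<Rightarrow> vec \<Rightarrow> nat \<Rightarrow> nat \<Rightarrow> bool" where
  "separated m P z i j \<longleftrightarrow>
     (z i - z j) mod m \<noteq> 0 \<and> (P i j \<longrightarrow> (z i + z j) mod m \<noteq> 0)"

lemma avoids_long_roots:
  "avoids n m (long_roots n P) z \<longleftrightarrow>
     (\<forall>i j. 1 \<le> i \<and> i < j \<and> j \<le> n \<longrightarrow> separated m P z i j)"
proof -
  have "pairing n z (eps i - eps j) = z i - z j" "pairing n z (eps i + eps j) = z i + z j"
    if "1 \<le> i" "i < j" "j \<le> n" for i j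
    using that by (auto simp: pairing_simps)
  moreover have "avoids n m (long_roots n P) z \<longleftrightarrow>
     (\<forall>i j. 1 \<le> i \<and> i < j \<and> j \<le> n \<longrightarrow> pairing n z (eps i - eps j) mod m \<noteq> 0 \<and>
        (P i j \<longrightarrow> pairing n z (eps i + eps j) mod m \<noteq> 0))"
    unfolding avoids_def long_roots_def ball_Un ball_family_iff by (rule iffI; simp)
  ultimately show ?thesis unfolding separated_def by metis
qed

lemma avoids_long_rootsD:
  "\<lbrakk>avoids n m (long_roots n P) z; 1 \<le> i; i < j; j \<le> n\<rbrakk> \<Longrightarrow> separated m P z i j"
  unfolding avoids_long_roots by blast

lemma avoids_eps: "avoids n m (eps ` {1..n}) z \<longleftrightarrow> (\<forall>i\<in>{1..n}. z i mod m \<noteq> 0)"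
  by (simp add: avoids_def pairing_eps)

lemma avoids_Un: "avoids n m (A \<union> B) z \<longleftrightarrow> avoids n m A z \<and> avoids n m B z"
  by (simp add: avoids_def ball_Un)

text \<open>
  The root \<open>\<epsilon>\<^sub>1 - \<epsilon>\<^sub>l\<close> dominates every difference, and \<open>\<epsilon>\<^sub>1 + \<epsilon>\<^sub>l\<close> dominates \<open>\<epsilon>\<^sub>l\<^sub>-\<^sub>1 + \<epsilon>\<^sub>l\<close>; the
  latter makes the minimum defining \<open>s\<close> meaningful.
\<close>

lemma ideal_D_eq_long_roots:
  assumes "3 \<le> l" and I: "ideal_D l I" and "eps 1 + eps l \<in> I" "eps 1 - eps l \<in> I"
  defines "P \<equiv> \<lambda>i j. eps i + eps j \<in> I"
  shows "I = long_roots l P" "up_closed l P" "P (l - 1) l"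
proof -
  define C where "C = root_cone l (simple_root_D l)"
  have down: "\<gamma> \<in> I" if "\<beta> \<in> I" "\<gamma> \<in> pos_roots_D l" "\<beta> - \<gamma> \<in> C" for \<beta> \<gamma>
    using I that unfolding root_ideal_def root_ge_iff C_def by blast
  have step: "(eps i - eps a) + (eps j - eps b) \<in> C"
    if "1 \<le> i" "i \<le> a" "a \<le> l" "1 \<le> j" "j \<le> b" "b \<le> l" for i a j b
    unfolding C_def using that by (intro root_cone_add eps_diff_in_cone_D) auto
  have minus: "eps i - eps j \<in> I" if "1 \<le> i" "i < j" "j \<le> l" for i j
  proof (rule down [OF assms(4)])
    show "eps i - eps j \<in> pos_roots_D l"
      using that by (auto simp: pos_roots_D_def)
    have eq: "eps 1 - eps l - (eps i - eps j) = (eps 1 - eps i) + (eps j - eps l)"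
      by simp
    show "eps 1 - eps l - (eps i - eps j) \<in> C"
      unfolding eq by (rule step) (use that in auto)
  qed
  have mono: "P a b" if "P i j" "1 \<le> i" "i \<le> a" "1 \<le> j" "j \<le> b" "a < b" "b \<le> l" for i j a b
    unfolding P_def
  proof (rule down [OF that(1) [unfolded P_def]])
    show "eps a + eps b \<in> pos_roots_D l"
      using that by (auto simp: pos_roots_D_def)
    have eq: "eps i + eps j - (eps a + eps b) = (eps i - eps a) + (eps j - eps b)"
      by simp
    show "eps i + eps j - (eps a + eps b) \<in> C"
      unfolding eq by (rule step) (use that in auto)
  qed
  show "up_closed l P"
    unfolding up_closed_def using mono by (meson less_imp_le order.trans)
  show "P (l - 1) l"
    using mono [of 1 l "l - 1" l] assms(1,3) by (auto simp: P_def)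
  show "I = long_roots l P"
  proof (intro equalityI subsetI)
    fix v assume v: "v \<in> I"
    then have "v \<in> pos_roots_D l"
      using I by (auto simp: root_ideal_def)
    with v show "v \<in> long_roots l P"
      unfolding pos_roots_D_def long_roots_def P_def by auto
  next
    fix v assume "v \<in> long_roots l P"
    then show "v \<in> I"
      using minus unfolding long_roots_def P_def by auto
  qed
qed


section \<open>Deleting a coordinate\<close>

text \<open>
  The increasing enumeration of the positive integers other than \<open>k\<close>; \<open>unskip k\<close> inverts it away
  from \<open>k\<close>.
\<close>

definition skip :: "nat \<Rightarrow> nat \<Rightarrow> nat" where
  "skip k i = (if i < k then i else i + 1)"

definition unskip :: "nat \<Rightarrow> nat \<Rightarrow> nat" where
  "unskip k i = (if i < k then i else i - 1)"

lemma skip_less_iff [simp]: "skip k i < skip k j \<longleftrightarrow> i < j"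
  and skip_neq [simp]: "skip k i \<noteq> k"
  and unskip_skip [simp]: "unskip k (skip k i) = i"
  and skip_unskip: "i \<noteq> k \<Longrightarrow> skip k (unskip k i) = i"
  by (auto simp: skip_def unskip_def)

lemma inj_skip: "inj (skip k)"
  by (metis injI unskip_skip)

lemma skip_bounds: "1 \<le> i \<Longrightarrow> i \<le> l - 1 \<Longrightarrow> skip k i \<in> {1..l}"
  by (auto simp: skip_def)

lemma unskip_bounds: "k \<in> {1..l} \<Longrightarrow> i \<in> {1..l} \<Longrightarrow> i \<noteq> k \<Longrightarrow> unskip k i \<in> {1..l - 1}"
  by (auto simp: unskip_def)

lemma up_closed_skip:
  assumes "up_closed l P"
  shows "up_closed (l - 1) (\<lambda>i j. P (skip k i) (skip k j))"
  unfolding up_closed_def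
proof (intro allI impI, elim conjE)
  fix i j a b
  assume *: "P (skip k i) (skip k j)" "1 \<le> i" "i < j" "i \<le> a" "j \<le> b" "a < b" "b \<le> l - 1"
  then have "1 \<le> skip k i" "skip k i < skip k j" "skip k i \<le> skip k a" "skip k j \<le> skip k b"
    "skip k a < skip k b" "skip k b \<le> l"
    by (auto simp: skip_def)
  with * assms show "P (skip k a) (skip k b)"
    unfolding up_closed_def by blast
qed

lemma card_row_sums_skip:
  assumes "k \<in> {1..l}" "i \<in> {1..l - 1}"
  shows "card (row_sums (l - 1) (\<lambda>i j. P (skip k i) (skip k j)) i) =
    card (row_sums l P (skip k i) - {k})"
proof -
  have "row_sums l P (skip k i) - {k} =
      skip k ` row_sums (l - 1) (\<lambda>i j. P (skip k i) (skip k j)) i"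
  proof (intro equalityI subsetI)
    fix j assume j: "j \<in> row_sums l P (skip k i) - {k}"
    then have "j = skip k (unskip k j)" "unskip k j \<le> l - 1"
      using unskip_bounds [of k l j] assms by (auto simp: skip_unskip row_sums_def)
    moreover from this have "i < unskip k j"
      using j skip_less_iff [of k i "unskip k j"] by (auto simp: row_sums_def)
    ultimately show "j \<in> skip k ` row_sums (l - 1) (\<lambda>i j. P (skip k i) (skip k j)) i"
      using j by (intro image_eqI [of _ _ "unskip k j"]) (auto simp: row_sums_def)
  next
    fix j assume "j \<in> skip k ` row_sums (l - 1) (\<lambda>i j. P (skip k i) (skip k j)) i"
    then show "j \<in> row_sums l P (skip k i) - {k}"
      using assms skip_bounds [of _ l k] by (auto simp: row_sums_def)
  qed
  then show ?thesis
    by (metis card_image inj_skip inj_on_subset subset_UNIV)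
qed

lemma s_index_long_roots:
  assumes "2 \<le> l" "P (l - 1) l"
  defines "s \<equiv> s_index l (long_roots l P)"
  shows "2 \<le> s" "s \<le> l" "P (s - 1) s"
    "\<And>k. \<lbrakk>2 \<le> k; k < s\<rbrakk> \<Longrightarrow> \<not> P (k - 1) k"
proof -
  let ?A = "{k. 2 \<le> k \<and> k \<le> l \<and> P (k - 1) k}"
  have "{k. 2 \<le> k \<and> k \<le> l \<and> eps (k - 1) + eps k \<in> long_roots l P} = ?A"
    by (auto simp: eps_sum_in_long_roots)
  then have s: "s = Min ?A"
    by (simp add: s_def s_index_def)
  have fin: "finite ?A"
    by (auto intro: finite_subset [of _ "{..l}"])
  moreover have "l \<in> ?A"
    using assms by auto
  ultimately have "s \<in> ?A"
    unfolding s by (intro Min_in) auto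
  then show "2 \<le> s" "s \<le> l" "P (s - 1) s" by auto
  show "\<not> P (k - 1) k" if "2 \<le> k" "k < s" for k
  proof
    assume "P (k - 1) k"
    with that \<open>s \<le> l\<close> have "k \<in> ?A" by auto
    then have "s \<le> k"
      unfolding s using fin by (rule Min_le [rotated])
    with that show False by simp
  qed
qed

text \<open>
  The prescribed row lengths are those obtained by deleting the index \<open>k\<close> and adjoining the short
  roots. Row \<open>i < k\<close> loses \<open>\<epsilon>\<^sub>i - \<epsilon>\<^sub>k\<close>, possibly loses \<open>\<epsilon>\<^sub>i + \<epsilon>\<^sub>k\<close>, and gains \<open>\<epsilon>\<^sub>i\<close>; row \<open>i \<ge> k\<close> is the old
  row \<open>i + 1\<close> with one more root. The case distinction at \<open>s\<close> in the prescription is consistent with this: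
  no sum involving two indices below \<open>s\<close> is present, whereas from row \<open>s - 1\<close> on all sums are present,
  so that \<open>p\<^sub>i\<^sub>+\<^sub>1 + 1 = p\<^sub>i - 1\<close> there.
\<close>

lemma SG_U_long_roots:
  assumes l: "2 \<le> l" and up: "up_closed l P" and last: "P (l - 1) l"
    and k: "k \<in> {1..l}" and i: "i \<in> {1..l - 1}"
  shows "SG_U l (long_roots l P) k i =
    int (card (row_sums (l - 1) (\<lambda>i j. P (skip k i) (skip k j)) i)) + int (l - 1 - i) + 1"
proof -
  define s where "s = s_index l (long_roots l P)"
  note s = s_index_long_roots [OF l, of P, OF last, folded s_def]
  define r where "r i = row_sums l P i" for i
  have SG: "int (SG l (long_roots l P) i) = int (card (r i)) + int (l - i)" if "i \<in> {1..l}" for i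
    using that by (simp add: SG_long_roots r_def)
  have up': "P a b" if "P i j" "1 \<le> i" "i < j" "i \<le> a" "j \<le> b" "a < b" "b \<le> l" for i j a b
    using up that unfolding up_closed_def by blast
  have full: "r j = {j<..l}" if "s \<le> j + 1" "j \<in> {1..l}" for j
    using that s(1) up' [OF s(3), of j] by (auto simp: r_def row_sums_def)
  have "card (r (skip k i) - {k}) + (l - 1 - i) + 1 = SG_U l (long_roots l P) k i"
  proof (cases "i < k")
    case True
    have card: "int (card (r i - {k})) = int (card (r i)) - (if P i k then 1 else 0)"
    proof (cases "P i k")
      case P: True
      then have "k \<in> r i"
        using True k by (auto simp: r_def row_sums_def)
      moreover from this have "card (r i) > 0"
        using finite_row_sums [of l P i] by (auto simp: r_def card_gt_0_iff)
      ultimately show ?thesis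
        using P by (simp add: card_Diff_singleton)
    next
      case False
      then have "r i - {k} = r i"
        by (auto simp: r_def row_sums_def)
      then show ?thesis using False by simp
    qed
    have small: "\<not> P i k" if "k + 2 \<le> s"
    proof
      assume "P i k"
      then have "P k (k + 1)"
        using up' [of i k k "k + 1"] True i that s(2) by auto
      then show False
        using s(4) [of "k + 1"] that k by auto
    qed
    have large: "P i k" if "s \<le> i + 1"
      using up' [OF s(3), of i k] that True k s(1) by auto
    have tau: "tau (long_roots l P) i k = (if P i k then 1 else 0)"
      using True i k by (simp add: tau_def eps_sum_in_long_roots)
    show ?thesis
      using card small large True i k
      by (auto simp: SG_U_def s_def [symmetric] SG tau skip_def)
  next
    case False
    have "k \<notin> r (i + 1)"
      using False by (auto simp: r_def row_sums_def)
    then have deleted: "r (skip k i) - {k} = r (i + 1)"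
      using False by (auto simp: skip_def)
    show ?thesis
    proof (cases "k + 2 \<le> s")
      case True
      then have "SG_U l (long_roots l P) k i = int (SG l (long_roots l P) (i + 1)) + 1"
        using False by (simp add: SG_U_def s_def [symmetric])
      also have "\<dots> = int (card (r (i + 1))) + int (l - (i + 1)) + 1"
        using i by (subst SG) auto
      finally show ?thesis by (simp add: deleted)
    next
      case large: False
      then have "SG_U l (long_roots l P) k i = int (SG l (long_roots l P) i) - 1"
        using False by (simp add: SG_U_def s_def [symmetric])
      also have "\<dots> = int (card (r i)) + int (l - i) - 1"
        using i by (subst SG) auto
      also have "\<dots> = int (card (r (i + 1))) + int (l - 1 - i) + 1"
        using full [of i] full [of "i + 1"] i large False by (auto simp: of_nat_diff)
      finally show ?thesis by (simp add: deleted)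
    qed
  qed
  then show ?thesis
    unfolding card_row_sums_skip [OF k i] r_def by simp
qed

lemma U_ideal_long_roots:
  assumes "2 \<le> l" "up_closed l P" "P (l - 1) l" "k \<in> {1..l}"
  shows "U_ideal l (long_roots l P) k =
    long_roots (l - 1) (\<lambda>i j. P (skip k i) (skip k j)) \<union> eps ` {1..l - 1}" (is "_ = ?V")
  unfolding U_ideal_def
proof (rule the_equality)
  have V: "ideal_B (l - 1) ?V"
    by (intro ideal_B_long_roots up_closed_skip assms)
  have SG: "int (SG (l - 1) ?V i) = SG_U l (long_roots l P) k i" if "i \<in> {1..l - 1}" for i
    unfolding SG_U_long_roots [OF assms that] SG_long_roots_eps [OF that] by simp
  show "ideal_B (l - 1) ?V \<and> (\<forall>i\<in>{1..l - 1}. int (SG (l - 1) ?V i) = SG_U l (long_roots l P) k i)"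
    by (intro conjI ballI V SG)
  fix U
  assume U: "ideal_B (l - 1) U \<and> (\<forall>i\<in>{1..l - 1}. int (SG (l - 1) U i) = SG_U l (long_roots l P) k i)"
  show "U = ?V"
  proof (rule ideal_B_eqI [OF _ V])
    show "ideal_B (l - 1) U"
      using U ..
    fix i assume i: "i \<in> {1..l - 1}"
    with U have "int (SG (l - 1) U i) = SG_U l (long_roots l P) k i" by blast
    with SG [OF i] show "SG (l - 1) U i = SG (l - 1) ?V i" by linarith
  qed
qed


section \<open>Points with a vanishing coordinate\<close>

lemma pairing_cong: "(\<And>i. i \<in> {1..n} \<Longrightarrow> z i = w i) \<Longrightarrow> pairing n z \<beta> = pairing n w \<beta>"
  by (simp add: pairing_def)

lemma avoids_cong:
  assumes "\<And>i. i \<in> {1..n} \<Longrightarrow> z i = w i"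
  shows "avoids n m \<Psi> z \<longleftrightarrow> avoids n m \<Psi> w"
  using pairing_cong [OF assms] by (simp add: avoids_def)

lemma separated_skip:
  "separated m (\<lambda>i j. P (skip k i) (skip k j)) (\<lambda>i. z (skip k i)) i j \<longleftrightarrow>
     separated m P z (skip k i) (skip k j)"
  by (simp add: separated_def)

text \<open>
  When \<open>z k = 0\<close>, the conditions from the pairs containing \<open>k\<close> say that the other coordinates are nonzero,
  and these are the conditions from the short roots. In particular a sum \<open>P i k\<close> adds nothing to the
  corresponding difference.
\<close>

lemma avoids_zero_coordinate:
  assumes k: "k \<in> {1..l}" and z: "z k = 0"
  shows "avoids l m (long_roots l P) z \<longleftrightarrow>
    avoids (l - 1) m (long_roots (l - 1) (\<lambda>i j. P (skip k i) (skip k j)) \<union> eps ` {1..l - 1})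
      (\<lambda>i. z (skip k i))" (is "?L \<longleftrightarrow> ?R")
proof
  assume L: ?L
  have nz: "z (skip k i) mod m \<noteq> 0" if i: "i \<in> {1..l - 1}" for i
  proof (cases "i < k")
    case True
    then have "separated m P z i k"
      using i k by (intro avoids_long_rootsD [OF L]) auto
    then show ?thesis
      using True z by (simp add: skip_def separated_def)
  next
    case False
    then have "separated m P z k (i + 1)"
      using i k by (intro avoids_long_rootsD [OF L]) auto
    then show ?thesis
      using False z by (simp add: skip_def separated_def mod_eq_0_iff_dvd)
  qed
  have sep: "separated m P z (skip k i) (skip k j)" if "1 \<le> i" "i < j" "j \<le> l - 1" for i j
    using skip_bounds [of i l k] skip_bounds [of j l k] that
    by (intro avoids_long_rootsD [OF L]) auto
  show ?R
    unfolding avoids_Un avoids_eps avoids_long_roots separated_skip [of m P k z]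
    by (intro conjI allI impI ballI nz sep) auto
next
  assume R: ?R
  have nz: "z j mod m \<noteq> 0" if "j \<in> {1..l}" "j \<noteq> k" for j
    using R unskip_bounds [OF k that] skip_unskip [OF that(2)] unfolding avoids_Un avoids_eps by metis
  have pairs: "separated m P z i j" if "i \<noteq> k" "j \<noteq> k" "1 \<le> i" "i < j" "j \<le> l" for i j
  proof -
    have "unskip k i \<in> {1..l - 1}" "unskip k j \<in> {1..l - 1}"
      using unskip_bounds [OF k, of i] unskip_bounds [OF k, of j] that by simp_all
    moreover have "unskip k i < unskip k j"
      using that skip_less_iff [of k "unskip k i" "unskip k j"] by (simp add: skip_unskip)
    ultimately have "separated m (\<lambda>i j. P (skip k i) (skip k j)) (\<lambda>i. z (skip k i)) (unskip k i) (unskip k j)"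
      using R unfolding avoids_Un by (intro avoids_long_rootsD [of "l - 1"]) auto
    then have "separated m P z (skip k (unskip k i)) (skip k (unskip k j))"
      unfolding separated_skip [of m P k z] .
    then show ?thesis
      using that by (simp add: skip_unskip)
  qed
  show ?L
    unfolding avoids_long_roots
  proof (intro allI impI)
    fix i j assume ij: "1 \<le> i \<and> i < j \<and> j \<le> l"
    consider "i = k" | "j = k" | "i \<noteq> k" "j \<noteq> k" by blast
    then show "separated m P z i j"
    proof cases
      case 1
      then show ?thesis using nz [of j] ij z by (simp add: separated_def mod_eq_0_iff_dvd)
    next
      case 2
      then show ?thesis using nz [of i] ij z by (simp add: separated_def)
    next
      case 3
      then show ?thesis using pairs ij by blast
    qed
  qed
qed

lemma card_zero_coordinate:
  assumes k: "k \<in> {1..l}" and q: "0 < q"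
  shows "card {z \<in> {1..l} \<rightarrow>\<^sub>E {0..<int q}. avoids l (int q) (long_roots l P) z \<and> z k = 0} =
    chi_quasi (l - 1) T_matrix
      (long_roots (l - 1) (\<lambda>i j. P (skip k i) (skip k j)) \<union> eps ` {1..l - 1}) q"
    (is "card ?A = chi_quasi _ _ ?V _")
proof -
  define F :: "vec \<Rightarrow> vec" where "F z = restrict (\<lambda>i. z (skip k i)) {1..l - 1}" for z
  define G :: "vec \<Rightarrow> vec" where
    "G y = restrict (\<lambda>j. if j = k then 0 else y (unskip k j)) {1..l}" for y
  let ?B = "{y \<in> {1..l - 1} \<rightarrow>\<^sub>E {0..<int q}. avoids (l - 1) (int q) ?V y}"
  have GF: "G (F z) = z" if "z \<in> {1..l} \<rightarrow>\<^sub>E {0..<int q}" "z k = 0" for z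
  proof
    fix j
    show "G (F z) j = z j"
      using that unskip_bounds [OF k, of j] by (auto simp: F_def G_def skip_unskip PiE_def extensional_def)
  qed
  have FG: "F (G y) = y" if "y \<in> {1..l - 1} \<rightarrow>\<^sub>E {0..<int q}" for y
  proof
    fix j
    show "F (G y) j = y j"
      using that skip_bounds [of j l k] by (auto simp: F_def G_def PiE_def extensional_def)
  qed
  have F_mem: "F z \<in> {1..l - 1} \<rightarrow>\<^sub>E {0..<int q}" if "z \<in> {1..l} \<rightarrow>\<^sub>E {0..<int q}" for z
    using that skip_bounds [of _ l k] unfolding F_def by (auto simp: PiE_iff)
  have G_mem: "G y \<in> {1..l} \<rightarrow>\<^sub>E {0..<int q}" if "y \<in> {1..l - 1} \<rightarrow>\<^sub>E {0..<int q}" for y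
    using that unskip_bounds [OF k] q unfolding G_def by (auto simp: PiE_iff)
  have F_avoids: "avoids (l - 1) (int q) ?V (F z) \<longleftrightarrow> avoids l (int q) (long_roots l P) z"
    if "z k = 0" for z
    unfolding avoids_zero_coordinate [of k l z, OF k that] F_def by (rule avoids_cong) simp
  have G_zero: "G y k = 0" for y
    using k by (simp add: G_def)
  have "bij_betw F ?A ?B"
  proof (rule bij_betw_byWitness [where f' = G])
    show "\<forall>z\<in>?A. G (F z) = z"
      using GF by simp
    show "\<forall>y\<in>?B. F (G y) = y"
      using FG by simp
    show "F ` ?A \<subseteq> ?B"
      using F_mem F_avoids by (auto simp del: PiE_iff)
    show "G ` ?B \<subseteq> ?A"
    proof (intro image_subsetI CollectI conjI)
      fix y assume y: "y \<in> ?B"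
      then show "G y \<in> {1..l} \<rightarrow>\<^sub>E {0..<int q}" using G_mem by simp
      show "G y k = 0" by (rule G_zero)
      then show "avoids l (int q) (long_roots l P) (G y)"
        using F_avoids [of "G y"] FG y by simp
    qed
  qed
  then show ?thesis
    unfolding chi_quasi_T_matrix by (rule bij_betw_same_card)
qed

text \<open>
  The differences force the coordinates to be distinct, so at most one of them vanishes.
\<close>

lemma chi_quasi_long_roots_split:
  assumes q: "0 < q"
  shows "chi_quasi l T_matrix (long_roots l P) q =
    chi_quasi l T_matrix (long_roots l P \<union> eps ` {1..l}) q +
    (\<Sum>k = 1..l. chi_quasi (l - 1) T_matrix
       (long_roots (l - 1) (\<lambda>i j. P (skip k i) (skip k j)) \<union> eps ` {1..l - 1}) q)"
proof -
  define X where "X = {z \<in> {1..l} \<rightarrow>\<^sub>E {0..<int q}. avoids l (int q) (long_roots l P) z}"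
  define A where "A k = {z \<in> {1..l} \<rightarrow>\<^sub>E {0..<int q}. avoids l (int q) (long_roots l P) z \<and> z k = 0}" for k
  define N where "N = {z \<in> X. \<forall>i\<in>{1..l}. z i \<noteq> 0}"
  have fin: "finite X"
    by (rule finite_subset [OF _ finite_PiE [of "{1..l}" "\<lambda>_. {0..<int q}"]]) (auto simp: X_def)
  have A: "A k = {z \<in> X. z k = 0}" for k
    by (auto simp: A_def X_def)
  have mod: "z i mod int q \<noteq> 0 \<longleftrightarrow> z i \<noteq> 0" if "z \<in> X" "i \<in> {1..l}" for z i
  proof -
    have "z i \<in> {0..<int q}" using that by (auto simp: X_def PiE_iff)
    then show ?thesis by simp
  qed
  have "N = {z \<in> X. \<forall>i\<in>{1..l}. z i mod int q \<noteq> 0}"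
    unfolding N_def by (intro Collect_cong conj_cong refl ball_cong) (simp only: mod)
  then have N: "N = {z \<in> {1..l} \<rightarrow>\<^sub>E {0..<int q}. avoids l (int q) (long_roots l P \<union> eps ` {1..l}) z}"
    unfolding avoids_Un avoids_eps X_def by simp
  have disjoint: "A i \<inter> A j = {}" if "i \<in> {1..l}" "j \<in> {1..l}" "i < j" for i j
    using that by (auto simp: A_def separated_def dest: avoids_long_rootsD [where i = i and j = j])
  have "card X = card (N \<union> (\<Union>k\<in>{1..l}. A k))"
    by (rule arg_cong [of _ _ card]) (auto simp: N_def A)
  also have "\<dots> = card N + card (\<Union>k\<in>{1..l}. A k)"
    by (rule card_Un_disjoint) (use fin in \<open>auto simp: N_def A\<close>)
  also have "card (\<Union>k\<in>{1..l}. A k) = (\<Sum>k\<in>{1..l}. card (A k))"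
  proof (rule card_UN_disjoint)
    show "\<forall>k\<in>{1..l}. finite (A k)"
      using fin by (simp add: A)
    show "\<forall>i\<in>{1..l}. \<forall>j\<in>{1..l}. i \<noteq> j \<longrightarrow> A i \<inter> A j = {}"
      using disjoint by (metis inf_commute linorder_neqE_nat)
  qed simp
  also have "\<dots> = (\<Sum>k = 1..l. chi_quasi (l - 1) T_matrix
       (long_roots (l - 1) (\<lambda>i j. P (skip k i) (skip k j)) \<union> eps ` {1..l - 1}) q)"
    unfolding A_def by (intro sum.cong refl card_zero_coordinate q)
  finally show ?thesis
    unfolding chi_quasi_T_matrix [of l] N X_def .
qed

section \<open>Counting signed injections\<close>

text \<open>
  Choose the values in the order \<open>f n, \<dots>, f 1\<close>. The values forbidden for \<open>f m\<close> are \<open>f j\<close> for all \<open>j > m\<close>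
  and \<open>\<nu> (f j)\<close> for the \<open>j\<close> in \<open>row_sums n P m\<close>. They are pairwise distinct whatever the earlier choices:
  if \<open>P m j\<close> and \<open>i > m\<close> differs from \<open>j\<close>, then \<open>P\<close> also holds for the pair of \<open>i\<close> and \<open>j\<close>, so the earlier
  choices satisfy \<open>f i \<noteq> \<nu> (f j)\<close>; and for \<open>i = j\<close> this is the absence of fixed points. Hence the
  number of admissible values for \<open>f m\<close> does not depend on the earlier choices. The count is stated over the integers, because
  a factor may be negative when the product vanishes.
\<close>

lemma card_signed_injections:
  fixes \<nu> :: "'a \<Rightarrow> 'a"
  assumes B: "finite B" and \<nu>: "\<And>b. b \<in> B \<Longrightarrow> \<nu> b \<in> B" "\<And>b. b \<in> B \<Longrightarrow> \<nu> (\<nu> b) = b"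
      "\<And>b. b \<in> B \<Longrightarrow> \<nu> b \<noteq> b"
    and P: "up_closed n P"
  shows "int (card {f \<in> {1..n} \<rightarrow>\<^sub>E B.
      \<forall>i j. 1 \<le> i \<and> i < j \<and> j \<le> n \<longrightarrow> f i \<noteq> f j \<and> (P i j \<longrightarrow> f i \<noteq> \<nu> (f j))}) =
    (\<Prod>i = 1..n. int (card B) - int (card (row_sums n P i) + (n - i)))"
proof -
  define F where "F m = {f \<in> {m..n} \<rightarrow>\<^sub>E B.
      \<forall>i j. m \<le> i \<and> i < j \<and> j \<le> n \<longrightarrow> f i \<noteq> f j \<and> (P i j \<longrightarrow> f i \<noteq> \<nu> (f j))}" for m
  define t where "t i = int (card B) - int (card (row_sums n P i) + (n - i))" for i
  define forbidden where "forbidden m g = g ` {m<..n} \<union> (\<lambda>j. \<nu> (g j)) ` row_sums n P m" for m g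
  have finite_F: "finite (F m)" for m
    by (rule finite_subset [OF _ finite_PiE [of "{m..n}" "\<lambda>_. B"]]) (use B in \<open>auto simp: F_def\<close>)
  have "int (card (F m)) = (\<Prod>i = m..n. t i)"
    if "1 \<le> m" "m \<le> n + 1" for m
    using that(2,1)
  proof (induction rule: inc_induct)
    case base
    have "F (n + 1) = {\<lambda>_. undefined}"
      by (auto simp: F_def)
    then show ?case by simp
  next
    case (step m)
    have m: "1 \<le> m" "m \<le> n" "{m..n} = insert m {Suc m..n}"
      using step by auto
    have card_forbidden: "card (forbidden m g) = card (row_sums n P m) + (n - m)"
      and forbidden_subset: "forbidden m g \<subseteq> B" if "g \<in> F (Suc m)" for g
    proof -
      have g: "g j \<in> B" if "m < j" "j \<le> n" for j
        using that \<open>g \<in> F (Suc m)\<close> by (auto simp: F_def PiE_iff)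
      have diff: "g i \<noteq> g j" "P i j \<Longrightarrow> g i \<noteq> \<nu> (g j)" if "m < i" "i < j" "j \<le> n" for i j
        using that \<open>g \<in> F (Suc m)\<close> by (auto simp: F_def)
      show "forbidden m g \<subseteq> B"
        using g \<nu>(1) by (auto simp: forbidden_def row_sums_def)
      have inj: "inj_on g {m<..n}"
        using diff(1) by (intro linorder_inj_onI) auto
      have "inj_on (\<lambda>j. \<nu> (g j)) (row_sums n P m)"
      proof (rule inj_onI)
        fix i j assume ij: "i \<in> row_sums n P m" "j \<in> row_sums n P m" "\<nu> (g i) = \<nu> (g j)"
        have "\<nu> (\<nu> (g i)) = g i" "\<nu> (\<nu> (g j)) = g j"
          using ij(1,2) by (auto simp: row_sums_def intro!: \<nu>(2) g)
        with ij(3) have "g i = g j" by metis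
        then show "i = j"
          by (rule inj_onD [OF inj]) (use ij in \<open>auto simp: row_sums_def\<close>)
      qed
      moreover have "g i \<noteq> \<nu> (g j)" if i: "i \<in> {m<..n}" and j: "j \<in> row_sums n P m" for i j
      proof -
        consider "i < j" | "j < i" | "i = j" by linarith
        then show ?thesis
        proof cases
          case 1
          have "P i j"
            by (rule up_closedD [OF P, of m j]) (use i j m(1) 1 in \<open>auto simp: row_sums_def\<close>)
          then show ?thesis using diff(2) 1 i j by (auto simp: row_sums_def)
        next
          case 2
          have "P j i"
            by (rule up_closedD [OF P, of m j]) (use i j m(1) 2 in \<open>auto simp: row_sums_def\<close>)
          then have "g j \<noteq> \<nu> (g i)"
            using diff(2) 2 i j by (auto simp: row_sums_def)
          then show ?thesis
            using \<nu>(2) g i j by (auto simp: row_sums_def)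
        next
          case 3
          then show ?thesis using \<nu>(3) g i by (metis greaterThanAtMost_iff)
        qed
      qed
      then have "g ` {m<..n} \<inter> (\<lambda>j. \<nu> (g j)) ` row_sums n P m = {}"
        by blast
      ultimately show "card (forbidden m g) = card (row_sums n P m) + (n - m)"
        unfolding forbidden_def using inj
        by (subst card_Un_disjoint) (simp_all add: finite_row_sums card_image)
    qed
    have "F m = (\<lambda>(g, b). g(m := b)) ` (SIGMA g:F (Suc m). B - forbidden m g)"
    proof (intro equalityI subsetI)
      fix f assume f: "f \<in> F m"
      define g where "g = restrict f {Suc m..n}"
      have gf: "g j = f j" if "m < j" "j \<le> n" for j
        using that by (simp add: g_def)
      have "f = g(m := f m)"
        using f by (auto simp: g_def F_def fun_eq_iff PiE_def extensional_def)
      moreover have "g \<in> F (Suc m)"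
        using f by (auto simp: g_def F_def PiE_iff)
      moreover have "f m \<in> B - forbidden m g"
        using f m gf by (auto simp: forbidden_def F_def PiE_iff row_sums_def)
      ultimately show "f \<in> (\<lambda>(g, b). g(m := b)) ` (SIGMA g:F (Suc m). B - forbidden m g)"
        by (intro image_eqI [of _ _ "(g, f m)"]) auto
    next
      fix f assume "f \<in> (\<lambda>(g, b). g(m := b)) ` (SIGMA g:F (Suc m). B - forbidden m g)"
      then obtain g b where f: "f = g(m := b)" and g: "g \<in> F (Suc m)"
        and b: "b \<in> B" "b \<notin> forbidden m g"
        by auto
      have "f \<in> {m..n} \<rightarrow>\<^sub>E B"
        using f g b(1) m(2) by (auto simp: F_def PiE_iff extensional_def)
      moreover have "f i \<noteq> f j \<and> (P i j \<longrightarrow> f i \<noteq> \<nu> (f j))" if "m \<le> i" "i < j" "j \<le> n" for i j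
      proof (cases "i = m")
        case True
        then show ?thesis
          using f b that by (auto simp: forbidden_def row_sums_def)
      next
        case False
        then have "Suc m \<le> i" "i \<noteq> m" "j \<noteq> m" using that by auto
        then show ?thesis
          using f g that by (simp add: F_def)
      qed
      ultimately show "f \<in> F m"
        by (simp add: F_def)
    qed
    moreover have "inj_on (\<lambda>(g, b). g(m := b)) (SIGMA g:F (Suc m). B - forbidden m g)"
    proof (rule inj_onI, clarify)
      fix g b g' b'
      assume g: "g \<in> F (Suc m)" "g' \<in> F (Suc m)" and eq: "g(m := b) = g'(m := b')"
      have "g m = undefined" "g' m = undefined"
        using g by (auto simp: F_def PiE_def extensional_def)
      then have "g = g'"
        using eq by (metis fun_upd_triv fun_upd_upd)
      moreover have "b = b'"
        using eq by (metis fun_upd_same)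
      ultimately show "g = g' \<and> b = b'" by simp
    qed
    ultimately have "card (F m) = card (SIGMA g:F (Suc m). B - forbidden m g)"
      by (simp add: card_image)
    also have "\<dots> = (\<Sum>g\<in>F (Suc m). card (B - forbidden m g))"
      by (rule card_SigmaI) (use B finite_F in auto)
    finally have "int (card (F m)) = (\<Sum>g\<in>F (Suc m). int (card (B - forbidden m g)))"
      by (simp only: of_nat_sum)
    also have "\<dots> = (\<Sum>g\<in>F (Suc m). t m)"
    proof (rule sum.cong [OF refl])
      fix g assume g: "g \<in> F (Suc m)"
      show "int (card (B - forbidden m g)) = t m"
        using card_Diff_subset [OF finite_subset [OF forbidden_subset [OF g] B] forbidden_subset [OF g]]
          card_mono [OF B forbidden_subset [OF g]]
        unfolding card_forbidden [OF g] t_def by (simp only: of_nat_diff)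
    qed
    also have "\<dots> = int (card (F (Suc m))) * t m"
      by simp
    also have "\<dots> = (\<Prod>i = m..n. t i)"
      using step.IH by (simp add: m(3) mult.commute)
    finally show ?case .
  qed
  from this [of 1] show ?thesis
    by (simp add: F_def t_def)
qed


section \<open>Doubling homomorphisms from the root lattice\<close>

lemma pairing_simple_root_D:
  assumes "2 \<le> l" "i \<in> {1..l}"
  shows "pairing l w (simple_root_D l i) = (if i = l then w (l - 1) + w l else w i - w (i + 1))"
  using assms by (auto simp: simple_root_D_def pairing_simps)

text \<open>
  The vectors \<open>u\<close> are multiples of the fundamental coweights: \<open>(1, \<dots>, 1, 0, \<dots>, 0)\<close> with \<open>k\<close> ones for
  \<open>k < l - 1\<close>, and the doubled spin weights \<open>(1, \<dots>, 1, \<plusminus>1)\<close> for the last two indices. Pairing with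
  them extracts the coefficients of the simple roots.
\<close>

lemma dual_vector_D:
  assumes "2 \<le> l" "k \<in> {1..l}"
  obtains u m where "m \<noteq> 0"
    "\<And>i. i \<in> {1..l} \<Longrightarrow> pairing l u (simple_root_D l i) = (if i = k then m else 0)"
proof -
  consider "k = l" | "k = l - 1" | "k < l - 1" using assms by fastforce
  then show thesis
  proof cases
    case 1
    show thesis
      by (rule that [of 2 "\<lambda>_. 1"]) (use 1 assms in \<open>simp_all add: pairing_simple_root_D del: atLeastAtMost_iff\<close>)
  next
    case 2
    show thesis
      by (rule that [of 2 "\<lambda>j. if j = l then - 1 else 1"])
         (use 2 assms in \<open>auto simp: pairing_simple_root_D\<close>)
  next
    case 3
    show thesis
      by (rule that [of 1 "\<lambda>j. if j \<le> k then 1 else 0"])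
         (use 3 assms in \<open>auto simp: pairing_simple_root_D\<close>)
  qed
qed

lemma simple_coords_D_eqI:
  assumes l: "2 \<le> l" and c: "\<forall>i. i \<notin> {1..l} \<longrightarrow> c i = 0"
    and \<beta>: "\<beta> = (\<lambda>j. \<Sum>i = 1..l. c i * simple_root_D l i j)"
  shows "simple_coords l (simple_root_D l) \<beta> = c"
  unfolding simple_coords_def
proof (rule the_equality)
  show "(\<forall>i. i \<notin> {1..l} \<longrightarrow> c i = 0) \<and> \<beta> = (\<lambda>j. \<Sum>i = 1..l. c i * simple_root_D l i j)"
    using c \<beta> ..
  fix d assume d: "(\<forall>i. i \<notin> {1..l} \<longrightarrow> d i = 0) \<and> \<beta> = (\<lambda>j. \<Sum>i = 1..l. d i * simple_root_D l i j)"
  show "d = c"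
  proof
    fix k
    show "d k = c k"
    proof (cases "k \<in> {1..l}")
      case False
      then show ?thesis using c d by simp
    next
      case True
      obtain m u where m: "m \<noteq> 0"
        "\<And>i. i \<in> {1..l} \<Longrightarrow> pairing l u (simple_root_D l i) = (if i = k then m else 0)"
        by (rule dual_vector_D [OF l True]) (rule that)
      have coefficient: "pairing l u (\<lambda>j. \<Sum>i = 1..l. e i * simple_root_D l i j) = e k * m" for e
      proof -
        have "pairing l u (\<lambda>j. \<Sum>i = 1..l. e i * simple_root_D l i j) =
            (\<Sum>i = 1..l. e i * (if i = k then m else 0))"
          unfolding pairing_combination by (rule sum.cong) (simp_all add: m(2))
        also have "\<dots> = e k * m"
          using True by (simp add: if_distrib [of "\<lambda>x. _ * x"] cong: if_cong)
        finally show ?thesis .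
      qed
      have "d k * m = c k * m"
        using d \<beta> coefficient [of d] coefficient [of c] by simp
      then show ?thesis using m(1) by simp
    qed
  qed
qed

lemma pairing_simple_coords_D:
  assumes l: "2 \<le> l" and \<beta>: "\<beta> \<in> pos_roots_D l"
  shows "pairing l w \<beta> =
    (\<Sum>i = 1..l. simple_coords l (simple_root_D l) \<beta> i * pairing l w (simple_root_D l i))"
proof -
  have "\<beta> \<in> root_cone l (simple_root_D l)"
    using \<beta> eps_sum_in_cone_D eps_diff_in_cone_D unfolding pos_roots_D_def by auto
  then obtain c :: "nat \<Rightarrow> nat" where c: "\<beta> = (\<lambda>j. \<Sum>i = 1..l. int (c i) * simple_root_D l i j)"
    by (auto simp: root_cone_def)
  define d where "d i = (if i \<in> {1..l} then int (c i) else 0)" for i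
  have d: "\<beta> = (\<lambda>j. \<Sum>i = 1..l. d i * simple_root_D l i j)"
    unfolding c by (simp add: d_def)
  have "simple_coords l (simple_root_D l) \<beta> = d"
    using l _ d by (rule simple_coords_D_eqI) (simp add: d_def)
  then show ?thesis
    using pairing_combination [of l w d] d by simp
qed

text \<open>
  The vector \<open>w\<close> represents twice a homomorphism from the root lattice to the residues modulo \<open>m\<close>, which
  is given by its values \<open>z i\<close> on the simple roots. Both sides express that it vanishes at \<open>\<beta>\<close>.
\<close>

lemma dvd_pairing_double_iff:
  assumes l: "2 \<le> l" and \<beta>: "\<beta> \<in> pos_roots_D l"
    and w: "\<And>i. i \<in> {1..l} \<Longrightarrow> 2 * m dvd pairing l w (simple_root_D l i) - 2 * z i"
  shows "2 * m dvd pairing l w \<beta> \<longleftrightarrow>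
    m dvd (\<Sum>i = 1..l. z i * simple_coords l (simple_root_D l) \<beta> i)"
proof -
  let ?c = "simple_coords l (simple_root_D l) \<beta>"
  have "pairing l w \<beta> - 2 * (\<Sum>i = 1..l. z i * ?c i) =
      (\<Sum>i = 1..l. ?c i * (pairing l w (simple_root_D l i) - 2 * z i))"
    unfolding pairing_simple_coords_D [OF l \<beta>]
    by (simp add: sum_distrib_left sum_subtractf [symmetric] algebra_simps)
  then have "2 * m dvd pairing l w \<beta> - 2 * (\<Sum>i = 1..l. z i * ?c i)"
    by (simp only:) (intro dvd_sum dvd_mult w)
  then have "2 * m dvd pairing l w \<beta> \<longleftrightarrow> 2 * m dvd 2 * (\<Sum>i = 1..l. z i * ?c i)"
    using dvd_diff_commute by (metis dvd_add_right_iff diff_add_cancel)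
  then show ?thesis by simp
qed

text \<open>
  For \<open>z\<close> giving the values of a homomorphism on the simple roots, this solves for its doubled values
  on \<open>\<epsilon>\<^sub>1, \<dots>, \<epsilon>\<^sub>l\<close>. The last one is forced up to a multiple of \<open>q\<close> by
  \<open>2 \<epsilon>\<^sub>l = \<alpha>\<^sub>l - \<alpha>\<^sub>l\<^sub>-\<^sub>1\<close>, and \<open>b\<close> is the remaining choice; the others follow from
  \<open>\<epsilon>\<^sub>i = \<epsilon>\<^sub>l + \<alpha>\<^sub>i + \<dots> + \<alpha>\<^sub>l\<^sub>-\<^sub>1\<close>.
\<close>

definition lift_coords :: "nat \<Rightarrow> int \<Rightarrow> vec \<Rightarrow> int \<Rightarrow> vec" where
  "lift_coords l q z b =
     (\<lambda>i\<in>{1..l}. (z l - z (l - 1) + b * q + 2 * (\<Sum>m = i..<l. z m)) mod (2 * q))"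

lemma lift_coords_last:
  "1 \<le> l \<Longrightarrow> 2 * q dvd lift_coords l q z b l - (z l - z (l - 1) + b * q)"
  by (simp add: lift_coords_def mod_eq_dvd_iff [symmetric])

lemma lift_coords_simple_root:
  assumes l: "2 \<le> l" and i: "i \<in> {1..l}"
  shows "2 * q dvd pairing l (lift_coords l q z b) (simple_root_D l i) - 2 * z i"
proof -
  let ?w = "lift_coords l q z b"
  define X where "X i = z l - z (l - 1) + b * q + 2 * (\<Sum>m = i..<l. z m)" for i
  have w: "2 * q dvd ?w i - X i" if "i \<in> {1..l}" for i
    using that by (simp add: lift_coords_def X_def mod_eq_dvd_iff [symmetric])
  show ?thesis
  proof (cases "i = l")
    case True
    have "{l - 1..<l} = {l - 1}"
      using l by auto
    then have "pairing l ?w (simple_root_D l i) - 2 * z i =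
        (?w (l - 1) - X (l - 1)) + (?w l - X l) + 2 * q * b"
      using True l by (simp add: pairing_simple_root_D X_def algebra_simps)
    then show ?thesis
      using w [of l] w [of "l - 1"] l by simp
  next
    case False
    then have "X i = X (i + 1) + 2 * z i"
      using i by (simp add: X_def sum.atLeast_Suc_lessThan)
    then have "pairing l ?w (simple_root_D l i) - 2 * z i = (?w i - X i) - (?w (i + 1) - X (i + 1))"
      using False i l by (simp add: pairing_simple_root_D)
    then show ?thesis
      using w [of i] w [of "i + 1"] i False by (simp add: dvd_diff)
  qed
qed

lemma eq_of_dvd_diff:
  fixes a b q :: int
  assumes "q dvd a - b" "a \<in> {0..<q}" "b \<in> {0..<q}"
  shows "a = b"
  using assms by (metis atLeastLessThan_iff mod_eq_dvd_iff mod_pos_pos_trivial)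

lemma inj_on_lift_coords:
  assumes l: "2 \<le> l" and q: "0 < q"
  shows "inj_on (\<lambda>(z, b). lift_coords l q z b) (({1..l} \<rightarrow>\<^sub>E {0..<q}) \<times> {0, 1})"
proof (rule inj_onI, clarify)
  fix z z' :: vec and b b' :: int
  assume z: "z \<in> {1..l} \<rightarrow>\<^sub>E {0..<q}" "z' \<in> {1..l} \<rightarrow>\<^sub>E {0..<q}" and b: "b \<in> {0, 1}" "b' \<in> {0, 1}"
    and eq: "lift_coords l q z b = lift_coords l q z' b'"
  have l': "1 \<le> l" using l by simp
  have zz: "z i = z' i" if "i \<in> {1..l}" for i
  proof (rule eq_of_dvd_diff)
    let ?r = "pairing l (lift_coords l q z b) (simple_root_D l i)"
    have "2 * q dvd (?r - 2 * z' i) - (?r - 2 * z i)"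
      by (rule dvd_diff [OF lift_coords_simple_root [OF l that, of q z' b', folded eq]
            lift_coords_simple_root [OF l that, of q z b]])
    then have "2 * q dvd 2 * (z i - z' i)"
      by (simp add: algebra_simps)
    then show "q dvd z i - z' i"
      unfolding dvd_mult_cancel_left by simp
  qed (use z that in \<open>auto simp: PiE_iff\<close>)
  then have "z = z'"
    using z by (intro PiE_ext)
  moreover have "b = b'"
  proof (rule eq_of_dvd_diff)
    let ?r = "lift_coords l q z b l" and ?c = "z l - z (l - 1)"
    have "2 * q dvd (?r - (?c + b' * q)) - (?r - (?c + b * q))"
      by (rule dvd_diff [OF lift_coords_last [OF l', of q z' b', folded eq, folded \<open>z = z'\<close>]
            lift_coords_last [OF l', of q z b]])
    then have "2 * q dvd (b - b') * q"
      by (simp add: algebra_simps)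
    then show "2 dvd b - b'"
      unfolding dvd_mult_cancel_right using q by simp
  qed (use b in auto)
  ultimately show "z = z' \<and> b = b'" ..
qed

lemma lift_coords_same_parity:
  assumes "i \<in> {1..l}" "j \<in> {1..l}"
  shows "even (lift_coords l q z b i) \<longleftrightarrow> even (lift_coords l q z b j)"
  using assms by (simp add: lift_coords_def even_mod_2_iff dvd_mod_iff)

text \<open>
  Equal parity makes the values on the simple roots even, so they can be halved to recover \<open>z\<close>.
  The choice \<open>b\<close> is then read off the last coordinate, and the remaining coordinates agree by descending
  induction.
\<close>

lemma lift_coords_surj:
  assumes l: "2 \<le> l" and q: "0 < q" and w: "w \<in> {1..l} \<rightarrow>\<^sub>E {0..<2 * q}"
    and parity: "\<And>i. i \<in> {1..l} \<Longrightarrow> even (w i) \<longleftrightarrow> even (w l)"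
  obtains z b where "z \<in> {1..l} \<rightarrow>\<^sub>E {0..<q}" "b \<in> {0, 1}" "w = lift_coords l q z b"
proof -
  define z where "z = (\<lambda>i\<in>{1..l}. (pairing l w (simple_root_D l i) div 2) mod q)"
  have z: "2 * q dvd pairing l w (simple_root_D l i) - 2 * z i" if i: "i \<in> {1..l}" for i
  proof -
    have "even (pairing l w (simple_root_D l i))"
      unfolding pairing_simple_root_D [OF l i]
      using parity [of i] parity [of "i + 1"] parity [of "l - 1"] i l by auto
    then have "pairing l w (simple_root_D l i) - 2 * z i =
        2 * (pairing l w (simple_root_D l i) div 2 - pairing l w (simple_root_D l i) div 2 mod q)"
      using i by (simp add: z_def algebra_simps)
    then show ?thesis by (simp add: minus_mod_eq_mult_div)
  qed
  define c where "c = z l - z (l - 1)"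
  have "2 * q dvd (pairing l w (simple_root_D l l) - 2 * z l)
      - (pairing l w (simple_root_D l (l - 1)) - 2 * z (l - 1))"
    by (rule dvd_diff [OF z z]) (use l in auto)
  also have "\<dots> = 2 * (w l - c)"
    using l by (auto simp: pairing_simple_root_D c_def)
  finally have "q dvd w l - c"
    unfolding dvd_mult_cancel_left by simp
  then obtain t where t: "w l - c = q * t" ..
  define b where "b = t mod 2"
  have "w l - (c + b * q) = 2 * q * (t div 2)"
    using t by (simp add: b_def algebra_simps minus_mod_eq_mult_div [symmetric])
  then have last: "2 * q dvd w l - (c + b * q)"
    by simp
  have "2 * q dvd w i - (c + b * q + 2 * (\<Sum>m = i..<l. z m))" if "i \<le> l" "1 \<le> i" for i
    using that
  proof (induction rule: inc_induct)
    case base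
    then show ?case using last by simp
  next
    case (step i)
    have "2 * q dvd (w (Suc i) - (c + b * q + 2 * (\<Sum>m = Suc i..<l. z m)))
        + (pairing l w (simple_root_D l i) - 2 * z i)"
      by (rule dvd_add [OF step.IH z]) (use step in auto)
    also have "\<dots> = w i - (c + b * q + 2 * (\<Sum>m = i..<l. z m))"
      using step l by (simp add: pairing_simple_root_D sum.atLeast_Suc_lessThan)
    finally show ?case .
  qed
  then have "w i mod (2 * q) = (c + b * q + 2 * (\<Sum>m = i..<l. z m)) mod (2 * q)" if "i \<in> {1..l}" for i
    using that by (simp add: mod_eq_dvd_iff)
  moreover have "w i mod (2 * q) = w i" if "i \<in> {1..l}" for i
    using w that by (auto simp: PiE_iff)
  ultimately have "w = lift_coords l q z b"
    using w by (intro PiE_ext [of w "{1..l}" "\<lambda>_. {0..<2 * q}"])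
       (use q in \<open>auto simp: lift_coords_def c_def PiE_iff\<close>)
  moreover have "z \<in> {1..l} \<rightarrow>\<^sub>E {0..<q}"
    using q by (auto simp: z_def)
  moreover have "b \<in> {0, 1}"
    by (auto simp: b_def)
  ultimately show thesis using that by blast
qed


section \<open>Even and odd points\<close>

text \<open>
  The map \<open>lift_coords\<close> is a bijection from pairs \<open>(z, b)\<close> with \<open>b \<in> {0, 1}\<close> onto the points modulo
  \<open>2 * q\<close> with coordinates of equal parity, and it transports the avoidance conditions.
\<close>

lemma twice_chi_quasi_S_matrix_D:
  assumes l: "2 \<le> l" and q: "0 < q" and \<Psi>: "\<Psi> \<subseteq> pos_roots_D l"
  shows "2 * chi_quasi l (S_matrix l (simple_root_D l)) \<Psi> q =
    card {w \<in> {1..l} \<rightarrow>\<^sub>E {0..<2 * int q}.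
      (\<forall>i\<in>{1..l}. even (w i) \<longleftrightarrow> even (w l)) \<and> avoids l (2 * int q) \<Psi> w}"
    (is "_ = card ?W")
proof -
  define Z where "Z = {z \<in> {1..l} \<rightarrow>\<^sub>E {0..<int q}.
    \<forall>\<beta>\<in>\<Psi>. (\<Sum>i = 1..l. z i * simple_coords l (simple_root_D l) \<beta> i) mod int q \<noteq> 0}"
  define f :: "vec \<times> int \<Rightarrow> vec" where "f = (\<lambda>(z, b). lift_coords l (int q) z b)"
  have q': "0 < int q" using q by simp
  have avoids: "avoids l (2 * int q) \<Psi> (lift_coords l (int q) z b) \<longleftrightarrow>
      (\<forall>\<beta>\<in>\<Psi>. (\<Sum>i = 1..l. z i * simple_coords l (simple_root_D l) \<beta> i) mod int q \<noteq> 0)" for z b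
    unfolding avoids_def
  proof (rule ball_cong [OF refl])
    fix \<beta> assume "\<beta> \<in> \<Psi>"
    with \<Psi> have "\<beta> \<in> pos_roots_D l" ..
    from dvd_pairing_double_iff [OF l this lift_coords_simple_root [OF l]]
    show "pairing l (lift_coords l (int q) z b) \<beta> mod (2 * int q) \<noteq> 0 \<longleftrightarrow>
        (\<Sum>i = 1..l. z i * simple_coords l (simple_root_D l) \<beta> i) mod int q \<noteq> 0"
      by (simp only: dvd_eq_mod_eq_0)
  qed
  have image: "f ` (Z \<times> {0, 1}) = ?W"
  proof (intro equalityI subsetI)
    fix w assume "w \<in> f ` (Z \<times> {0, 1})"
    then obtain z b where w: "w = lift_coords l (int q) z b" and z: "z \<in> Z"
      by (auto simp: f_def)
    show "w \<in> ?W"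
    proof (intro CollectI conjI ballI)
      show "w \<in> {1..l} \<rightarrow>\<^sub>E {0..<2 * int q}"
        using q by (auto simp: w lift_coords_def)
      show "even (w i) \<longleftrightarrow> even (w l)" if "i \<in> {1..l}" for i
        unfolding w using that l by (intro lift_coords_same_parity) auto
      show "avoids l (2 * int q) \<Psi> w"
        unfolding w avoids using z by (simp add: Z_def)
    qed
  next
    fix w assume "w \<in> ?W"
    then have w: "w \<in> {1..l} \<rightarrow>\<^sub>E {0..<2 * int q}"
      "\<And>i. i \<in> {1..l} \<Longrightarrow> even (w i) \<longleftrightarrow> even (w l)" "avoids l (2 * int q) \<Psi> w"
      by blast+
    obtain z b where zb: "z \<in> {1..l} \<rightarrow>\<^sub>E {0..<int q}" "b \<in> {0, 1}" "w = lift_coords l (int q) z b"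
      by (rule lift_coords_surj [OF l q' w(1,2)]) (assumption, rule that)
    then have "avoids l (2 * int q) \<Psi> (lift_coords l (int q) z b)"
      using w(3) by simp
    then have "z \<in> Z"
      unfolding avoids using zb(1) by (simp add: Z_def)
    then show "w \<in> f ` (Z \<times> {0, 1})"
      using zb by (intro image_eqI [of _ _ "(z, b)"]) (simp_all add: f_def)
  qed
  have "inj_on f (Z \<times> {0, 1})"
    unfolding f_def by (rule inj_on_subset [OF inj_on_lift_coords [OF l q']]) (auto simp: Z_def)
  then have "card ?W = card (Z \<times> {0 :: int, 1})"
    unfolding image [symmetric] by (rule card_image)
  also have "\<dots> = 2 * card Z"
    by (simp add: card_cartesian_product)
  also have "card Z = chi_quasi l (S_matrix l (simple_root_D l)) \<Psi> q"
    by (simp add: Z_def chi_quasi_def S_matrix_def)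
  finally show ?thesis by simp
qed

lemma card_even_points:
  assumes q: "0 < q"
  shows "card {w \<in> {1..l} \<rightarrow>\<^sub>E {0..<2 * int q}. (\<forall>i\<in>{1..l}. even (w i)) \<and> avoids l (2 * int q) \<Psi> w} =
    chi_quasi l T_matrix \<Psi> q" (is "card ?W = _")
proof -
  define f :: "vec \<Rightarrow> vec" where "f x = restrict (\<lambda>i. 2 * x i) {1..l}" for x
  define g :: "vec \<Rightarrow> vec" where "g w = restrict (\<lambda>i. w i div 2) {1..l}" for w
  let ?X = "{x \<in> {1..l} \<rightarrow>\<^sub>E {0..<int q}. avoids l (int q) \<Psi> x}"
  have pairing: "pairing l (f x) \<beta> = 2 * pairing l x \<beta>" for x \<beta>
    by (simp add: pairing_def f_def sum_distrib_left mult.assoc)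
  have avoids: "avoids l (2 * int q) \<Psi> (f x) \<longleftrightarrow> avoids l (int q) \<Psi> x" for x
    by (simp add: avoids_def pairing)
  have gf: "g (f x) = x" if "x \<in> {1..l} \<rightarrow>\<^sub>E {0..<int q}" for x
    using that by (auto simp: f_def g_def fun_eq_iff PiE_def extensional_def)
  have fg: "f (g w) = w" if "w \<in> {1..l} \<rightarrow>\<^sub>E {0..<2 * int q}" "\<forall>i\<in>{1..l}. even (w i)" for w
    using that by (auto simp: f_def g_def fun_eq_iff PiE_def extensional_def)
  have "bij_betw f ?X ?W"
  proof (rule bij_betw_byWitness [where f' = g])
    show "\<forall>x\<in>?X. g (f x) = x" using gf by simp
    show "\<forall>w\<in>?W. f (g w) = w" using fg by simp
    show "f ` ?X \<subseteq> ?W"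
    proof (intro image_subsetI CollectI conjI)
      fix x assume x: "x \<in> ?X"
      then show "f x \<in> {1..l} \<rightarrow>\<^sub>E {0..<2 * int q}" by (auto simp: f_def PiE_iff)
      show "\<forall>i\<in>{1..l}. even (f x i)" by (simp add: f_def)
      show "avoids l (2 * int q) \<Psi> (f x)" using x by (simp add: avoids)
    qed
    show "g ` ?W \<subseteq> ?X"
    proof (intro image_subsetI CollectI conjI)
      fix w assume w: "w \<in> ?W"
      then show "g w \<in> {1..l} \<rightarrow>\<^sub>E {0..<int q}" by (auto simp: g_def PiE_iff)
      show "avoids l (int q) \<Psi> (g w)" using w fg [of w] avoids [of "g w"] by simp
    qed
  qed
  then show ?thesis
    unfolding chi_quasi_T_matrix by (rule bij_betw_same_card [symmetric])
qed

lemma card_odd_residues: "card {b \<in> {0..<2 * int q}. odd b} = q"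
proof -
  have "bij_betw (\<lambda>k. 2 * int k + 1) {..<q} {b \<in> {0..<2 * int q}. odd b}"
  proof (rule bij_betw_byWitness [where f' = "\<lambda>b. nat (b div 2)"])
    show "(\<lambda>b. nat (b div 2)) ` {b \<in> {0..<2 * int q}. odd b} \<subseteq> {..<q}"
      by (auto simp: nat_less_iff)
  qed (auto elim!: oddE)
  from bij_betw_same_card [OF this] show ?thesis by simp
qed

text \<open>
  For even \<open>q\<close>, negation modulo \<open>2 * q\<close> has no fixed points among the odd residues, since its fixed points
  are \<open>0\<close> and \<open>q\<close>. The points are therefore signed injections into a set of \<open>q\<close> values.
\<close>

lemma card_odd_points:
  assumes q: "0 < q" "even q" and P: "up_closed l P"
  shows "int (card {w \<in> {1..l} \<rightarrow>\<^sub>E {0..<2 * int q}.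
      (\<forall>i\<in>{1..l}. odd (w i)) \<and> avoids l (2 * int q) (long_roots l P) w}) =
    (\<Prod>i = 1..l. int q - int (SG l (long_roots l P) i))" (is "int (card ?W) = _")
proof -
  define B where "B = {b \<in> {0..<2 * int q}. odd b}"
  define \<nu> where "\<nu> b = 2 * int q - b" for b
  have finite_B: "finite B"
    by (rule finite_subset [of _ "{0..<2 * int q}"]) (auto simp: B_def)
  have \<nu>: "\<nu> b \<in> B" "\<nu> (\<nu> b) = b" "\<nu> b \<noteq> b" if "b \<in> B" for b
  proof -
    have "b \<noteq> 0" "b \<noteq> int q"
      using that q by (auto simp: B_def)
    then show "\<nu> b \<in> B" "\<nu> (\<nu> b) = b" "\<nu> b \<noteq> b"
      using that by (auto simp: B_def \<nu>_def)
  qed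
  have separated: "separated (2 * int q) P w i j \<longleftrightarrow> w i \<noteq> w j \<and> (P i j \<longrightarrow> w i \<noteq> \<nu> (w j))"
    if "w i \<in> B" "w j \<in> B" for w i j
  proof -
    have "(w i - w j) mod (2 * int q) = 0 \<longleftrightarrow> w i = w j"
      using that eq_of_dvd_diff [of "2 * int q" "w i" "w j"]
      by (auto simp: B_def dvd_eq_mod_eq_0 [symmetric])
    moreover have "(w i + w j) mod (2 * int q) = 0 \<longleftrightarrow> w i = \<nu> (w j)"
    proof -
      have "w i + w j = w i - \<nu> (w j) + 2 * int q"
        by (simp add: \<nu>_def)
      then have "(w i + w j) mod (2 * int q) = (w i - \<nu> (w j)) mod (2 * int q)"
        by (simp only: mod_add_self2)
      then show ?thesis
        using that \<nu>(1) [of "w j"] eq_of_dvd_diff [of "2 * int q" "w i" "\<nu> (w j)"]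
        by (auto simp: B_def dvd_eq_mod_eq_0 [symmetric])
    qed
    ultimately show ?thesis
      by (simp add: separated_def)
  qed
  have "?W = {w \<in> {1..l} \<rightarrow>\<^sub>E B.
      \<forall>i j. 1 \<le> i \<and> i < j \<and> j \<le> l \<longrightarrow> w i \<noteq> w j \<and> (P i j \<longrightarrow> w i \<noteq> \<nu> (w j))}"
  proof -
    have "w \<in> {1..l} \<rightarrow>\<^sub>E B \<longleftrightarrow> w \<in> {1..l} \<rightarrow>\<^sub>E {0..<2 * int q} \<and> (\<forall>i\<in>{1..l}. odd (w i))" for w
      unfolding PiE_iff B_def by blast
    moreover have "avoids l (2 * int q) (long_roots l P) w \<longleftrightarrow>
        (\<forall>i j. 1 \<le> i \<and> i < j \<and> j \<le> l \<longrightarrow> w i \<noteq> w j \<and> (P i j \<longrightarrow> w i \<noteq> \<nu> (w j)))"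
      if "w \<in> {1..l} \<rightarrow>\<^sub>E B" for w
    proof -
      have "w i \<in> B" if "1 \<le> i" "i \<le> l" for i
        using that \<open>w \<in> {1..l} \<rightarrow>\<^sub>E B\<close> by (simp add: PiE_iff)
      then have "separated (2 * int q) P w i j \<longleftrightarrow> w i \<noteq> w j \<and> (P i j \<longrightarrow> w i \<noteq> \<nu> (w j))"
        if "1 \<le> i \<and> i < j \<and> j \<le> l" for i j
        using that by (intro separated) auto
      then show ?thesis
        unfolding avoids_long_roots by (intro iff_allI imp_cong refl)
    qed
    ultimately show ?thesis
      by (intro Collect_cong) (metis (lifting))
  qed
  then have "int (card ?W) = (\<Prod>i = 1..l. int (card B) - int (card (row_sums l P i) + (l - i)))"
    using card_signed_injections [of B \<nu> l P, OF finite_B \<nu> P] by (simp only:)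
  also have "\<dots> = (\<Prod>i = 1..l. int q - int (SG l (long_roots l P) i))"
    unfolding B_def card_odd_residues by (intro prod.cong refl) (simp only: SG_long_roots)
  finally show ?thesis .
qed

lemma twice_chi_quasi_S_matrix_long_roots:
  assumes l: "2 \<le> l" and q: "0 < q" "even q" and P: "up_closed l P"
  shows "2 * int (chi_quasi l (S_matrix l (simple_root_D l)) (long_roots l P) q) =
    int (chi_quasi l T_matrix (long_roots l P) q)
    + (\<Prod>i = 1..l. int q - int (SG l (long_roots l P) i))"
proof -
  let ?\<Psi> = "long_roots l P"
  let ?W = "{w \<in> {1..l} \<rightarrow>\<^sub>E {0..<2 * int q}.
      (\<forall>i\<in>{1..l}. even (w i) \<longleftrightarrow> even (w l)) \<and> avoids l (2 * int q) ?\<Psi> w}"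
  let ?E = "{w \<in> {1..l} \<rightarrow>\<^sub>E {0..<2 * int q}. (\<forall>i\<in>{1..l}. even (w i)) \<and> avoids l (2 * int q) ?\<Psi> w}"
  let ?O = "{w \<in> {1..l} \<rightarrow>\<^sub>E {0..<2 * int q}. (\<forall>i\<in>{1..l}. odd (w i)) \<and> avoids l (2 * int q) ?\<Psi> w}"
  have "l \<in> {1..l}" using l by simp
  then have "(\<forall>i\<in>{1..l}. even (w i) \<longleftrightarrow> even (w l)) \<longleftrightarrow>
      (\<forall>i\<in>{1..l}. even (w i)) \<or> (\<forall>i\<in>{1..l}. odd (w i))" for w :: vec
    by metis
  then have "?W = ?E \<union> ?O"
    by auto
  moreover have "?E \<inter> ?O = {}"
    using \<open>l \<in> {1..l}\<close> by blast
  moreover have "finite ?E" "finite ?O"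
    by (rule finite_subset [OF _ finite_PiE [of "{1..l}" "\<lambda>_. {0..<2 * int q}"]]; auto)+
  ultimately have "card ?W = card ?E + card ?O"
    by (simp add: card_Un_disjoint)
  moreover have "?\<Psi> \<subseteq> pos_roots_D l"
    by (auto simp: long_roots_def pos_roots_D_def)
  ultimately show ?thesis
    using twice_chi_quasi_S_matrix_D [OF l q(1), of ?\<Psi>] card_even_points [OF q(1), of l ?\<Psi>]
      card_odd_points [OF q P] by linarith
qed

theorem theorem3p9:
  fixes l q :: nat and I :: "vec set"
  assumes "l \<ge> 3"
    and "ideal_D l I"
    and "eps 1 + eps l \<in> I"
    and "eps 1 - eps l \<in> I"
    and "q > 0"
    and "even q"
  shows "real (chi_quasi l (S_matrix l (simple_root_D l)) I q) =
    1 / 2 * ((\<Sum>k = 1..l. real (chi_quasi (l - 1) T_matrix (U_ideal l I k) q))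
             + real (chi_quasi l T_matrix (K_ideal l I) q)
             + (\<Prod>i = 1..l. (real q - real (SG l I i))))"
proof -
  obtain P where I: "I = long_roots l P" and P: "up_closed l P" "P (l - 1) l"
    using ideal_D_eq_long_roots [OF assms(1-4)] by metis
  have l: "2 \<le> l" using assms(1) by simp
  have "chi_quasi l T_matrix I q = chi_quasi l T_matrix (K_ideal l I) q
      + (\<Sum>k = 1..l. chi_quasi (l - 1) T_matrix (U_ideal l I k) q)"
    unfolding I chi_quasi_long_roots_split [OF \<open>q > 0\<close>] K_ideal_def
    by (simp only: U_ideal_long_roots [OF l P] cong: sum.cong)
  moreover have "2 * real (chi_quasi l (S_matrix l (simple_root_D l)) I q) =
      real (chi_quasi l T_matrix I q) + (\<Prod>i = 1..l. (real q - real (SG l I i)))"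
    using arg_cong [OF twice_chi_quasi_S_matrix_long_roots [OF l \<open>q > 0\<close> \<open>even q\<close> P(1)],
        of real_of_int] unfolding I by simp
  ultimately show ?thesis by simp
qed

end
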